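(* There exists a conformal TIFS $\Psi=\{\phi_\tau\}_{\tau\in T\setminus\{\emptyset\}}$, with limit set $J$, such that $$\dim_H(J)=\beta^*(\Psi)=\frac{\log 2}{\log 3}<1=\beta(\Psi).$$ Here $\dim_H$ denotes Hausdorff dimension.
   Context: Trees. A rooted tree is a partially ordered set $(T,\preceq)$ with a minimum element $\emptyset$ (the root) such that for every $\tau\in T$ the set $\{\tau'\in T: \tau'\preceq\tau\}$ is order isomorphic to $(\{0,\dots,n\},\le)$ for some $n\ge 0$; this $n$ is the height $|\tau|$. Write $\tau\prec\omega$ if $\tau\preceq\omega$ and $\tau\neq\omega$. The set of successors of $\tau$ is $I_\tau=\{\omega\in T:\omega\succ\tau,\ |\omega|=|\tau|+1\}$. $T$ is assumed pruned and finitely splitting: $1\le \# I_\tau<\infty$ for every $\tau\in T$. For $n\ge 0$ let $T^{(n)}=\{\tau\in T:|\tau|=n\}$ and $T^{(\le n)}=\{\tau\in T:|\tau|\le n\}$. For $\tau\in T$ and $0\le n\le|\tau|$, $\tau|_n$ is the unique element with $\tau|_n\preceq\tau$ and $|\tau|_n|=n$. $\partial T$ is the set of infinite paths $\omega=(\emptyset=\omega|_0,\omega|_1,\omega|_2,\dots)$ with $\omega|_{n+1}\in I_{\omega|_n}$ for all $n$. TIFS. Let $X$ be a (nonempty) compact connected metric space. A Tree Iterated Function System (TIFS) is a family $\{\phi_\tau:X\to X\}_{\tau\in T\setminus\{\emptyset\}}$ for which there is $s\in(0,1)$ such that every $\phi_\tau$ is Lipschitz with constant $s$. Put $\Phi_\tau=\phi_{\tau|_1}\circ\phi_{\tau|_2}\circ\cdots\circ\phi_{\tau|_n}$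 for $|\tau|=n\ge1$, and $\Phi_\emptyset=\mathrm{Id}_X$. For $\omega\in\partial T$, the set $\bigcap_{n\ge1}\Phi_{\omega|_n}(X)$ is a single point, denoted $\pi(\omega)$; the limit set is $J=\pi(\partial T)$. Conformal TIFS (CTIFS). A TIFS is conformal if: 1. (Conformality) $X\subset\mathbb R^d$ for some $d\ge1$ (with the Euclidean metric), and there is an open set $V$ with $X\subset V\subset\mathbb R^d$ such that every $\phi_\tau$ extends to a map $V\to V$ (same notation) which is a $C^1$ diffeomorphism onto its image and conformal on $V$ (its derivative at each point is a nonzero scalar multiple of an orthogonal map); $\Phi_\tau$ is extended to $V$ accordingly. 2. (Open set condition) For all $\tau\in T$ and distinct $\omega,\rho\in I_\tau$, $\phi_\omega(\mathrm{Int}(X))\cap\phi_\rho(\mathrm{Int}(X))=\emptyset$, where $\mathrm{Int}$ is the interior in $\mathbb R^d$. 3. (Cone condition) There exist $0<\alpha<\pi$ and $l>0$ such that for every $x\in\partial X$ there is a unit vector $v\in\mathbb R^d$ with $\{y\in\mathbb R^d:0<\|y-x\|<l,\ (y-x,v)>\cos\alpha\}\subset\mathrm{Int}(X)$, where this set is the paper's notation $\mathrm{Con}(x,\alpha,l,v)$ for the open cone with vertex $x$, altitude $l$, angle $\alpha$, direction $v$. 4. (Bounded distortion) There is $K\ge1$ such that $|\Phi_\tau'(x)|\le K|\Phi_\tau'(y)|$ for all $\tau\in T$, $x,y\in V$, where $|\Phi_\tau'(x)|$ is the operator norm of the derivative. Put $\|\Phi_\omega'\|=\sup_{x\in X}|\Phi_\omega'(x)|$.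 An antichain in a poset is a subset whose distinct elements are pairwise incomparable; it is maximal if it is maximal under inclusion among antichains of that poset. For $n\ge1$ and $t\ge0$, $$Z_n^*(t)=\min\Big\{\sum_{\omega\in A}\|\Phi_\omega'\|^t : A \text{ is a maximal antichain in } T^{(\le n)}\setminus\{\emptyset\}\Big\},$$ $Z_\infty^*(t)=\lim_{n\to\infty}Z_n^*(t)$ (the sequence is non-increasing), and $\beta^*(\Psi)=\inf\{t\ge0: Z_\infty^*(t)=0\}$. Also $$Z_n(t)=\sum_{\tau\in T^{(n)}}\|\Phi_\tau'\|^t\quad(t\ge0),\qquad \beta(\Psi)=\inf\{t\ge0:\liminf_{n\to\infty}Z_n(t)=0\}.$$ *)

theory Defs
  imports "HOL-Analysis.Analysis" "HOL-Library.Poly_Mapping"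
begin

section \<open>The Euclidean spaces of all finite dimensions inside one type\<close>

text \<open>
  Being a conformal TIFS involves an existential quantifier over the dimension \<open>d\<close>, which cannot be
  expressed by a dimension that is a type. So finitely supported sequences are made an inner product
  space, and the Euclidean space of dimension \<open>d\<close> is its subspace \<open>euclid d\<close> of the sequences
  supported in \<open>{..<d}\<close>. Open sets, interiors, frontiers and derivatives are taken relative to
  that subspace.
\<close>

instantiation poly_mapping :: (type, real_vector) real_vector
begin

definition scaleR_poly_mapping :: "real \<Rightarrow> ('a \<Rightarrow>\<^sub>0 'b) \<Rightarrow> 'a \<Rightarrow>\<^sub>0 'b"
  where "scaleR_poly_mapping c x = Poly_Mapping.map (scaleR c) x"

lemma lookup_scaleR [simp]:
  "Poly_Mapping.lookup (c *\<^sub>R x) i = c *\<^sub>R Poly_Mapping.lookup (x :: 'a \<Rightarrow>\<^sub>0 'b) i"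
  by (simp add: scaleR_poly_mapping_def Poly_Mapping.map.rep_eq when_def)

instance
proof
  fix x y :: "'a \<Rightarrow>\<^sub>0 'b" and a b :: real
  show "a *\<^sub>R (x + y) = a *\<^sub>R x + a *\<^sub>R y"
    by (rule poly_mapping_eqI) (simp add: lookup_add scaleR_add_right)
  show "(a + b) *\<^sub>R x = a *\<^sub>R x + b *\<^sub>R x"
    by (rule poly_mapping_eqI) (simp add: lookup_add scaleR_add_left)
  show "a *\<^sub>R b *\<^sub>R x = (a * b) *\<^sub>R x"
    by (rule poly_mapping_eqI) simp
  show "1 *\<^sub>R x = x"
    by (rule poly_mapping_eqI) simp
qed

end

instantiation poly_mapping :: (type, real_inner) real_inner
begin

definition inner_poly_mapping :: "('a \<Rightarrow>\<^sub>0 'b) \<Rightarrow> ('a \<Rightarrow>\<^sub>0 'b) \<Rightarrow> real"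
  where "inner_poly_mapping x y =
    (\<Sum>i\<in>Poly_Mapping.keys x \<union> Poly_Mapping.keys y. Poly_Mapping.lookup x i \<bullet> Poly_Mapping.lookup y i)"

definition norm_poly_mapping :: "('a \<Rightarrow>\<^sub>0 'b) \<Rightarrow> real"
  where "norm_poly_mapping x = sqrt (x \<bullet> x)"

definition sgn_poly_mapping :: "('a \<Rightarrow>\<^sub>0 'b) \<Rightarrow> 'a \<Rightarrow>\<^sub>0 'b"
  where "sgn_poly_mapping x = x /\<^sub>R norm x"

definition dist_poly_mapping :: "('a \<Rightarrow>\<^sub>0 'b) \<Rightarrow> ('a \<Rightarrow>\<^sub>0 'b) \<Rightarrow> real"
  where "dist_poly_mapping x y = norm (x - y)"

definition uniformity_poly_mapping :: "(('a \<Rightarrow>\<^sub>0 'b) \<times> ('a \<Rightarrow>\<^sub>0 'b)) filter"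
  where "uniformity_poly_mapping = (INF e\<in>{0<..}. principal {(x, y). dist x y < e})"

definition open_poly_mapping :: "('a \<Rightarrow>\<^sub>0 'b) set \<Rightarrow> bool"
  where "open_poly_mapping U \<longleftrightarrow>
    (\<forall>x\<in>U. eventually (\<lambda>(x', y). x' = x \<longrightarrow> y \<in> U) uniformity)"

lemma inner_poly_mapping_superset:
  fixes x y :: "'a \<Rightarrow>\<^sub>0 'b"
  assumes "finite S" "Poly_Mapping.keys x \<subseteq> S \<or> Poly_Mapping.keys y \<subseteq> S"
  shows "x \<bullet> y = (\<Sum>i\<in>S. Poly_Mapping.lookup x i \<bullet> Poly_Mapping.lookup y i)"
proof -
  let ?f = "\<lambda>i. Poly_Mapping.lookup x i \<bullet> Poly_Mapping.lookup y i"
  let ?K = "Poly_Mapping.keys x \<inter> Poly_Mapping.keys y"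
  have "sum ?f ?K = sum ?f (Poly_Mapping.keys x \<union> Poly_Mapping.keys y)"
    by (rule sum.mono_neutral_left) (auto simp: in_keys_iff)
  moreover have "sum ?f ?K = sum ?f S"
    using assms by (intro sum.mono_neutral_left) (auto simp: in_keys_iff)
  ultimately show ?thesis by (simp add: inner_poly_mapping_def)
qed

instance
proof
  fix x y z :: "'a \<Rightarrow>\<^sub>0 'b" and a :: real and U :: "('a \<Rightarrow>\<^sub>0 'b) set"
  show "dist x y = norm (x - y)" by (rule dist_poly_mapping_def)
  show "sgn x = x /\<^sub>R norm x" by (rule sgn_poly_mapping_def)
  show "(uniformity :: (('a \<Rightarrow>\<^sub>0 'b) \<times> ('a \<Rightarrow>\<^sub>0 'b)) filter) =
      (INF e\<in>{0<..}. principal {(x, y). dist x y < e})"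
    by (rule uniformity_poly_mapping_def)
  show "open U \<longleftrightarrow> (\<forall>x\<in>U. eventually (\<lambda>(x', y). x' = x \<longrightarrow> y \<in> U) uniformity)"
    by (rule open_poly_mapping_def)
  show "x \<bullet> y = y \<bullet> x"
    by (simp add: inner_poly_mapping_def Un_commute inner_commute[where 'a = 'b])
  show "(x + y) \<bullet> z = x \<bullet> z + y \<bullet> z"
    by (simp add: inner_poly_mapping_superset[where S = "Poly_Mapping.keys z"]
        lookup_add inner_add_left sum.distrib)
  show "(a *\<^sub>R x) \<bullet> y = a * (x \<bullet> y)"
    by (simp add: inner_poly_mapping_superset[where S = "Poly_Mapping.keys y"] sum_distrib_left)
  show "0 \<le> x \<bullet> x"
    by (simp add: inner_poly_mapping_def sum_nonneg)
  show "x \<bullet> x = 0 \<longleftrightarrow> x = 0"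
  proof
    assume "x \<bullet> x = 0"
    then have "\<forall>i. i \<notin> Poly_Mapping.keys x"
      by (auto simp: inner_poly_mapping_def sum_nonneg_eq_0_iff in_keys_iff)
    then show "x = 0" by (intro poly_mapping_eqI) (simp add: in_keys_iff)
  qed (simp add: inner_poly_mapping_def)
  show "norm x = sqrt (x \<bullet> x)" by (rule norm_poly_mapping_def)
qed

end

definition euclid :: "nat \<Rightarrow> (nat \<Rightarrow>\<^sub>0 real) set"
  where "euclid d = {x. Poly_Mapping.keys x \<subseteq> {..<d}}"

lemma inner_euclid:
  assumes "x \<in> euclid d" "y \<in> euclid d"
  shows "x \<bullet> y = (\<Sum>i<d. Poly_Mapping.lookup x i * Poly_Mapping.lookup y i)"
  using assms by (simp add: euclid_def inner_poly_mapping_superset[where S = "{..<d}"])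

lemma subspace_euclid: "subspace (euclid d)"
proof (rule subspaceI)
  show "0 \<in> euclid d" by (simp add: euclid_def)
  show "x + y \<in> euclid d" if "x \<in> euclid d" "y \<in> euclid d" for x y
    using that Poly_Mapping.keys_add[of x y] by (auto simp: euclid_def)
  show "c *\<^sub>R x \<in> euclid d" if "x \<in> euclid d" for c x
    using that by (auto simp: euclid_def in_keys_iff subset_iff)
qed

section \<open>Hausdorff dimension\<close>

text \<open>The convention is \<open>0\<^sup>0 = 1\<close> for nonempty sets, whereas \<open>0 powr 0 = 0\<close>.\<close>

definition hausdorff_gauge :: "real \<Rightarrow> 'a::metric_space set \<Rightarrow> ennreal"
  where "hausdorff_gauge s U =
    (if U = {} then 0 else if s = 0 then 1 else ennreal (diameter U powr s))"

definition hausdorff_premeasure :: "real \<Rightarrow> real \<Rightarrow> 'a::metric_space set \<Rightarrow> ennreal"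
  where "hausdorff_premeasure s \<delta> A =
    (INF U\<in>{U :: nat \<Rightarrow> 'a set. A \<subseteq> (\<Union>i. U i) \<and> (\<forall>i. bounded (U i) \<and> diameter (U i) \<le> \<delta>)}.
      suminf (\<lambda>i. hausdorff_gauge s (U i)))"

definition hausdorff_measure :: "real \<Rightarrow> 'a::metric_space set \<Rightarrow> ennreal"
  where "hausdorff_measure s A = (SUP \<delta>\<in>{0<..}. hausdorff_premeasure s \<delta> A)"

definition hausdorff_dim :: "'a::metric_space set \<Rightarrow> ereal"
  where "hausdorff_dim A = Inf (ereal ` {s. 0 \<le> s \<and> hausdorff_measure s A = 0})"

section \<open>Trees\<close>

text \<open>A tree is a carrier \<open>T\<close> with an order relation \<open>r\<close>, where \<open>(\<sigma>, \<tau>) \<in> r\<close> means \<open>\<sigma> \<preceq> \<tau>\<close>.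
  A finitely splitting tree is countable, so every such tree has a copy inside any given countably
  infinite type.\<close>

definition height_is :: "('t \<times> 't) set \<Rightarrow> 't \<Rightarrow> nat \<Rightarrow> bool"
  where "height_is r \<tau> n \<longleftrightarrow>
    (\<exists>f. bij_betw f {\<sigma>. (\<sigma>, \<tau>) \<in> r} {0..n} \<and>
      (\<forall>\<sigma> \<rho>. (\<sigma>, \<tau>) \<in> r \<longrightarrow> (\<rho>, \<tau>) \<in> r \<longrightarrow> ((\<sigma>, \<rho>) \<in> r \<longleftrightarrow> f \<sigma> \<le> f \<rho>)))"

definition rooted_tree :: "'t set \<Rightarrow> ('t \<times> 't) set \<Rightarrow> bool"
  where "rooted_tree T r \<longleftrightarrow>
    partial_order_on T r \<and> (\<exists>z\<in>T. \<forall>\<tau>\<in>T. (z, \<tau>) \<in> r) \<and> (\<forall>\<tau>\<in>T. \<exists>n. height_is r \<tau> n)"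

definition tree_root :: "'t set \<Rightarrow> ('t \<times> 't) set \<Rightarrow> 't"
  where "tree_root T r = (THE z. z \<in> T \<and> (\<forall>\<tau>\<in>T. (z, \<tau>) \<in> r))"

definition tree_height :: "('t \<times> 't) set \<Rightarrow> 't \<Rightarrow> nat"
  where "tree_height r \<tau> = (THE n. height_is r \<tau> n)"

definition tree_succs :: "('t \<times> 't) set \<Rightarrow> 't \<Rightarrow> 't set"
  where "tree_succs r \<tau> =
    {\<omega>. (\<tau>, \<omega>) \<in> r \<and> \<omega> \<noteq> \<tau> \<and> tree_height r \<omega> = tree_height r \<tau> + 1}"

definition pruned_finitely_splitting_tree :: "'t set \<Rightarrow> ('t \<times> 't) set \<Rightarrow> bool"
  where "pruned_finitely_splitting_tree T r \<longleftrightarrow>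
    rooted_tree T r \<and> (\<forall>\<tau>\<in>T. tree_succs r \<tau> \<noteq> {} \<and> finite (tree_succs r \<tau>))"

definition tree_level :: "'t set \<Rightarrow> ('t \<times> 't) set \<Rightarrow> nat \<Rightarrow> 't set"
  where "tree_level T r n = {\<tau>\<in>T. tree_height r \<tau> = n}"

definition tree_upto :: "'t set \<Rightarrow> ('t \<times> 't) set \<Rightarrow> nat \<Rightarrow> 't set"
  where "tree_upto T r n = {\<tau>\<in>T. tree_height r \<tau> \<le> n}"

definition tree_restrict :: "('t \<times> 't) set \<Rightarrow> 't \<Rightarrow> nat \<Rightarrow> 't"
  where "tree_restrict r \<tau> n = (THE \<sigma>. (\<sigma>, \<tau>) \<in> r \<and> tree_height r \<sigma> = n)"

definition tree_boundary :: "'t set \<Rightarrow> ('t \<times> 't) set \<Rightarrow> (nat \<Rightarrow> 't) set"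
  where "tree_boundary T r =
    {\<omega>. \<omega> 0 = tree_root T r \<and> (\<forall>n. \<omega> (Suc n) \<in> tree_succs r (\<omega> n))}"

definition antichain :: "('t \<times> 't) set \<Rightarrow> 't set \<Rightarrow> bool"
  where "antichain r A \<longleftrightarrow> (\<forall>\<sigma>\<in>A. \<forall>\<tau>\<in>A. \<sigma> \<noteq> \<tau> \<longrightarrow> (\<sigma>, \<tau>) \<notin> r \<and> (\<tau>, \<sigma>) \<notin> r)"

definition maximal_antichain :: "'t set \<Rightarrow> ('t \<times> 't) set \<Rightarrow> 't set \<Rightarrow> bool"
  where "maximal_antichain P r A \<longleftrightarrow>
    A \<subseteq> P \<and> antichain r A \<and> (\<forall>B. B \<subseteq> P \<longrightarrow> antichain r B \<longrightarrow> A \<subseteq> B \<longrightarrow> A = B)"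

section \<open>Tree iterated function systems\<close>

definition TIFS :: "'x::metric_space set \<Rightarrow> 't set \<Rightarrow> ('t \<times> 't) set \<Rightarrow> ('t \<Rightarrow> 'x \<Rightarrow> 'x) \<Rightarrow> bool"
  where "TIFS X T r \<phi> \<longleftrightarrow>
    pruned_finitely_splitting_tree T r \<and> X \<noteq> {} \<and> compact X \<and> connected X \<and>
    (\<exists>s. 0 < s \<and> s < 1 \<and>
      (\<forall>\<tau>\<in>T - {tree_root T r}. \<phi> \<tau> ` X \<subseteq> X \<and> lipschitz_on s X (\<phi> \<tau>)))"

definition tifs_comp :: "('t \<times> 't) set \<Rightarrow> ('t \<Rightarrow> 'x \<Rightarrow> 'x) \<Rightarrow> 't \<Rightarrow> 'x \<Rightarrow> 'x"
  where "tifs_comp r \<phi> \<tau> =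
    foldr (\<circ>) (map (\<lambda>k. \<phi> (tree_restrict r \<tau> k)) [1..<Suc (tree_height r \<tau>)]) id"

definition coding_map ::
    "'x set \<Rightarrow> ('t \<times> 't) set \<Rightarrow> ('t \<Rightarrow> 'x \<Rightarrow> 'x) \<Rightarrow> (nat \<Rightarrow> 't) \<Rightarrow> 'x"
  where "coding_map X r \<phi> \<omega> = (THE x. (\<Inter>n\<in>{1..}. tifs_comp r \<phi> (\<omega> n) ` X) = {x})"

definition limit_set :: "'x set \<Rightarrow> 't set \<Rightarrow> ('t \<times> 't) set \<Rightarrow> ('t \<Rightarrow> 'x \<Rightarrow> 'x) \<Rightarrow> 'x set"
  where "limit_set X T r \<phi> = coding_map X r \<phi> ` tree_boundary T r"

section \<open>Conformal maps relative to a subspace\<close>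

text \<open>
  In this section \<open>E\<close> is a finite-dimensional subspace and \<open>V\<close> is relatively open in \<open>E\<close>.
  The derivative of a map \<open>V \<rightarrow> E\<close> at a point is a linear map on \<open>E\<close>; the library's \<open>has_derivative\<close>
  (at a point within \<open>E\<close>) determines it on \<open>E\<close> and leaves it arbitrary (but bounded linear) off \<open>E\<close>.
\<close>

definition C1_on :: "'v::real_normed_vector set \<Rightarrow> 'v set \<Rightarrow> ('v \<Rightarrow> 'v) \<Rightarrow> bool"
  where "C1_on E V f \<longleftrightarrow>
    (\<exists>f' :: 'v \<Rightarrow> 'v \<Rightarrow>\<^sub>L 'v.
      (\<forall>x\<in>V. (f has_derivative blinfun_apply (f' x)) (at x within E)) \<and> continuous_on V f')"

definition C1_diffeo_onto_image ::
    "'v::real_normed_vector set \<Rightarrow> 'v set \<Rightarrow> ('v \<Rightarrow> 'v) \<Rightarrow> bool"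
  where "C1_diffeo_onto_image E V f \<longleftrightarrow>
    C1_on E V f \<and> inj_on f V \<and> openin (top_of_set E) (f ` V) \<and> C1_on E (f ` V) (inv_into V f)"

text \<open>
  Orthogonal maps of \<open>E\<close> are the restrictions of the orthogonal maps of the whole space that
  preserve \<open>E\<close>.
\<close>

definition conformal_on :: "'v::real_inner set \<Rightarrow> 'v set \<Rightarrow> ('v \<Rightarrow> 'v) \<Rightarrow> bool"
  where "conformal_on E V f \<longleftrightarrow>
    (\<forall>x\<in>V. \<exists>c Q. c \<noteq> 0 \<and> orthogonal_transformation Q \<and> Q ` E = E \<and>
      (f has_derivative (\<lambda>h. c *\<^sub>R Q h)) (at x within E))"

definition deriv_norm :: "'v::real_normed_vector set \<Rightarrow> ('v \<Rightarrow> 'v) \<Rightarrow> 'v \<Rightarrow> real"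
  where "deriv_norm E f x = (SUP h\<in>E. norm (frechet_derivative f (at x within E) h) / norm h)"

definition sup_deriv_norm :: "'v::real_normed_vector set \<Rightarrow> 'v set \<Rightarrow> ('v \<Rightarrow> 'v) \<Rightarrow> real"
  where "sup_deriv_norm E X f = (SUP x\<in>X. deriv_norm E f x)"

text \<open>
  Membership in the open cone with vertex \<open>x\<close>, angle \<open>\<alpha>\<close> and direction \<open>v\<close> means that the angle
  between \<open>y - x\<close> and \<open>v\<close> is less than \<open>\<alpha>\<close>. This is sometimes abbreviated to
  \<open>(y - x) \<bullet> v > cos \<alpha>\<close>, with \<open>y - x\<close> understood to be normalised; read without normalisation,
  that formula would allow the set to be empty and the cone condition to be void.
\<close>

definition open_cone ::
    "'v::real_inner set \<Rightarrow> 'v \<Rightarrow> real \<Rightarrow> real \<Rightarrow> 'v \<Rightarrow> 'v set"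
  where "open_cone E x \<alpha> l v =
    {y\<in>E. 0 < norm (y - x) \<and> norm (y - x) < l \<and> (y - x) \<bullet> v > norm (y - x) * cos \<alpha>}"

section \<open>Conformal tree iterated function systems\<close>

text \<open>
  \<open>\<phi> \<tau>\<close> stands both for the map \<open>X \<rightarrow> X\<close> and for its extension \<open>V \<rightarrow> V\<close>; its values off \<open>V\<close> are
  irrelevant.
\<close>

definition conformal_TIFS ::
    "nat \<Rightarrow> (nat \<Rightarrow>\<^sub>0 real) set \<Rightarrow> 't set \<Rightarrow> ('t \<times> 't) set
      \<Rightarrow> ('t \<Rightarrow> (nat \<Rightarrow>\<^sub>0 real) \<Rightarrow> (nat \<Rightarrow>\<^sub>0 real)) \<Rightarrow> bool"
  where "conformal_TIFS d X T r \<phi> \<longleftrightarrow>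
    TIFS X T r \<phi> \<and> 1 \<le> d \<and>
    (\<exists>V. openin (top_of_set (euclid d)) V \<and> X \<subseteq> V \<and>
      (\<forall>\<tau>\<in>T - {tree_root T r}. \<phi> \<tau> ` V \<subseteq> V \<and>
        C1_diffeo_onto_image (euclid d) V (\<phi> \<tau>) \<and> conformal_on (euclid d) V (\<phi> \<tau>)) \<and>
      (\<exists>K\<ge>1. \<forall>\<tau>\<in>T. \<forall>x\<in>V. \<forall>y\<in>V.
        deriv_norm (euclid d) (tifs_comp r \<phi> \<tau>) x
          \<le> K * deriv_norm (euclid d) (tifs_comp r \<phi> \<tau>) y)) \<and>
    (\<forall>\<tau>\<in>T. \<forall>\<omega>\<in>tree_succs r \<tau>. \<forall>\<rho>\<in>tree_succs r \<tau>. \<omega> \<noteq> \<rho> \<longrightarrow>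
      \<phi> \<omega> ` (top_of_set (euclid d) interior_of X) \<inter>
      \<phi> \<rho> ` (top_of_set (euclid d) interior_of X) = {}) \<and>
    (\<exists>\<alpha> l. 0 < \<alpha> \<and> \<alpha> < pi \<and> 0 < l \<and>
      (\<forall>x\<in>top_of_set (euclid d) frontier_of X. \<exists>v\<in>euclid d. norm v = 1 \<and>
        open_cone (euclid d) x \<alpha> l v \<subseteq> top_of_set (euclid d) interior_of X))"

definition antichain_pressure ::
    "nat \<Rightarrow> (nat \<Rightarrow>\<^sub>0 real) set \<Rightarrow> 't set \<Rightarrow> ('t \<times> 't) set
      \<Rightarrow> ('t \<Rightarrow> (nat \<Rightarrow>\<^sub>0 real) \<Rightarrow> (nat \<Rightarrow>\<^sub>0 real)) \<Rightarrow> nat \<Rightarrow> real \<Rightarrow> real"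
  where "antichain_pressure d X T r \<phi> n t =
    Min {\<Sum>\<omega>\<in>A. sup_deriv_norm (euclid d) X (tifs_comp r \<phi> \<omega>) powr t | A.
      maximal_antichain (tree_upto T r n - {tree_root T r}) r A}"

definition beta_star ::
    "nat \<Rightarrow> (nat \<Rightarrow>\<^sub>0 real) set \<Rightarrow> 't set \<Rightarrow> ('t \<times> 't) set
      \<Rightarrow> ('t \<Rightarrow> (nat \<Rightarrow>\<^sub>0 real) \<Rightarrow> (nat \<Rightarrow>\<^sub>0 real)) \<Rightarrow> ereal"
  where "beta_star d X T r \<phi> =
    Inf (ereal ` {t. 0 \<le> t \<and> lim (\<lambda>n. antichain_pressure d X T r \<phi> n t) = 0})"

definition level_pressure ::
    "nat \<Rightarrow> (nat \<Rightarrow>\<^sub>0 real) set \<Rightarrow> 't set \<Rightarrow> ('t \<times> 't) set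
      \<Rightarrow> ('t \<Rightarrow> (nat \<Rightarrow>\<^sub>0 real) \<Rightarrow> (nat \<Rightarrow>\<^sub>0 real)) \<Rightarrow> nat \<Rightarrow> real \<Rightarrow> real"
  where "level_pressure d X T r \<phi> n t =
    (\<Sum>\<tau>\<in>tree_level T r n. sup_deriv_norm (euclid d) X (tifs_comp r \<phi> \<tau>) powr t)"

definition beta ::
    "nat \<Rightarrow> (nat \<Rightarrow>\<^sub>0 real) set \<Rightarrow> 't set \<Rightarrow> ('t \<times> 't) set
      \<Rightarrow> ('t \<Rightarrow> (nat \<Rightarrow>\<^sub>0 real) \<Rightarrow> (nat \<Rightarrow>\<^sub>0 real)) \<Rightarrow> ereal"
  where "beta d X T r \<phi> =
    Inf (ereal ` {t. 0 \<le> t \<and> liminf (\<lambda>n. ereal (level_pressure d X T r \<phi> n t)) = 0})"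

end

theory Submission
  imports Defs "HOL-Library.Sublist"
begin

text \<open>
  The system lives on \<open>X = [0, 1]\<close>, placed on the first coordinate axis, and its tree consists of
  the words over \<open>{0, 1}\<close>. The map of a nonempty word \<open>w\<close> is a similarity that keeps the left end
  of the interval if \<open>w\<close> ends in \<open>0\<close> and the right end if it ends in \<open>1\<close>. Its ratio is
  \<open>1 / 2\<close> (dyadic: the two children of a node tile its interval) or \<open>1 / 3\<close> (triadic: the middle third is
  removed). If \<open>w\<close> has \<open>k\<close> leading zeros, the ratio is \<open>1 / 2\<close> for \<open>|w| \<le> (k + 1)\<^sup>2\<close> and \<open>1 / 3\<close> beyond.
  So the words \<open>0, 00, 000, \<dots>\<close> form a dyadic spine, and each subtree that leaves the spine is
  eventually triadic, but the later the subtree leaves, the longer this takes.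

  The level sums see the delay. At level \<open>n\<close>, all words with at least \<open>\<surd>n\<close> leading zeros are still
  dyadic, so that \<open>Z\<^sub>n(t)\<close> is at least about \<open>2\<^bsup>n (1 - t) - \<surd>n\<^esup>\<close>, which is unbounded for \<open>t < 1\<close>; and
  \<open>Z\<^sub>n(t) \<le> 2\<^bsup>n (1 - t)\<^esup>\<close> since all ratios are at most \<open>1 / 2\<close>. Hence \<open>\<beta> = 1\<close>
  (\<open>level_sum_ge_1\<close>, \<open>level_sum_tendsto_0\<close>).

  Antichains need not cut all subtrees at one level and so can wait until the delay is over. The antichain
  made of \<open>0\<^sup>M\<close> and of all words of length \<open>L\<close> with fewer than \<open>M\<close> leading zeros with \<open>L \<ge> M\<^sup>2\<close> costs at most
  \<open>2\<^bsup>-tM\<^esup> + 2\<^sup>L 3\<^bsup>-t (L - M\<^sup>2)\<^esup>\<close>. For \<open>t > log 2 / log 3\<close> this is small once \<open>M\<close> and then \<open>L\<close> are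
  large (\<open>exists_spine_cut_sum_less\<close>). The corresponding intervals cover the limit set, so both
  \<open>\<beta>\<^sup>*\<close> and the Hausdorff dimension are at most \<open>log 2 / log 3\<close>.

  For the lower bounds let \<open>0 \<le> t \<le> log 2 / log 3\<close>, that is, \<open>3\<^sup>-\<^sup>t \<ge> 1 / 2\<close>. Since all ratios are at least
  \<open>1 / 3\<close>, the sum over a maximal antichain is at least \<open>\<Sum>2\<^bsup>-|w|\<^esup>\<close>, and this is at least \<open>1\<close>
  by Kraft's counting argument (\<open>sum_half_power_maximal_antichain\<close>). The subtree above \<open>1\<close> is triadic at once, so the
  limit set contains a scaled copy of the Cantor set. The Cantor function maps it onto an
  interval and is Hoelder continuous with exponent \<open>log 2 / log 3\<close>, hence the \<open>t\<close>-dimensional Hausdorff measure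
  does not vanish (\<open>hausdorff_measure_nonzero\<close>, \<open>address_separation\<close>).
\<close>

section \<open>The binary tree of words\<close>

definition binary_words :: "nat list set"
  where "binary_words = {w. set w \<subseteq> {0, 1}}"

definition prefix_rel :: "(nat list \<times> nat list) set"
  where "prefix_rel = {(u, w). w \<in> binary_words \<and> prefix u w}"

lemma append_binary_words_iff [simp]:
  "u @ w \<in> binary_words \<longleftrightarrow> u \<in> binary_words \<and> w \<in> binary_words"
  by (auto simp: binary_words_def)

lemma Nil_binary_words [simp]: "[] \<in> binary_words"
  by (simp add: binary_words_def)

lemma Cons_binary_words_iff [simp]:
  "i # w \<in> binary_words \<longleftrightarrow> i \<in> {0, 1} \<and> w \<in> binary_words"
  by (auto simp: binary_words_def)

lemma replicate_binary_words [simp]: "i \<in> {0, 1} \<Longrightarrow> replicate n i \<in> binary_words"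
  by (auto simp: binary_words_def)

lemma prefix_binary_words: "prefix u w \<Longrightarrow> w \<in> binary_words \<Longrightarrow> u \<in> binary_words"
  by (auto simp: prefix_def)

lemma take_binary_words [simp]: "w \<in> binary_words \<Longrightarrow> take n w \<in> binary_words"
  using prefix_binary_words take_is_prefix by blast

lemma prefix_rel_iff: "(u, w) \<in> prefix_rel \<longleftrightarrow> w \<in> binary_words \<and> prefix u w"
  by (simp add: prefix_rel_def)

lemma binary_words_length_eq: "{w \<in> binary_words. length w = n} = {w. set w \<subseteq> {0, 1} \<and> length w = n}"
  by (auto simp: binary_words_def)

lemma finite_binary_words_length: "finite {w \<in> binary_words. length w = n}"
  unfolding binary_words_length_eq by (rule finite_lists_length_eq) simp

lemma card_binary_words_length: "card {w \<in> binary_words. length w = n} = 2 ^ n"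
  unfolding binary_words_length_eq by (subst card_lists_length_eq) (simp_all add: numeral_2_eq_2)

lemma card_binary_words_extending:
  assumes "a \<in> binary_words" "length a \<le> n"
  shows "card {w \<in> binary_words. length w = n \<and> prefix a w} = 2 ^ (n - length a)"
proof -
  have "{w \<in> binary_words. length w = n \<and> prefix a w}
      = (@) a ` {u \<in> binary_words. length u = n - length a}"
    using assms by (auto simp: prefix_def)
  moreover have "inj_on ((@) a) S" for S
    by (simp add: inj_on_def)
  ultimately show ?thesis
    by (simp add: card_image card_binary_words_length)
qed

lemma height_is_prefix_rel:
  assumes "w \<in> binary_words"
  shows "height_is prefix_rel w n \<longleftrightarrow> n = length w"
proof
  assume "height_is prefix_rel w n"
  then obtain f where "bij_betw f {u. (u, w) \<in> prefix_rel} {0..n}"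
    by (auto simp: height_is_def)
  then have "card {u. (u, w) \<in> prefix_rel} = Suc n"
    by (simp add: bij_betw_same_card)
  moreover have "{u. (u, w) \<in> prefix_rel} = set (prefixes w)"
    using assms by (auto simp: prefix_rel_iff)
  ultimately show "n = length w"
    by (simp add: distinct_card distinct_prefixes)
next
  assume n: "n = length w"
  have "bij_betw length {u. (u, w) \<in> prefix_rel} {0..n}"
    unfolding bij_betw_def
  proof
    show "inj_on length {u. (u, w) \<in> prefix_rel}"
      by (auto simp: inj_on_def prefix_rel_iff prefix_def append_eq_append_conv2)
    show "length ` {u. (u, w) \<in> prefix_rel} = {0..n}"
    proof (intro set_eqI iffI)
      fix k assume "k \<in> {0..n}"
      then have "k = length (take k w)" "(take k w, w) \<in> prefix_rel"
        using assms n by (auto simp: prefix_rel_iff take_is_prefix)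
      then show "k \<in> length ` {u. (u, w) \<in> prefix_rel}" by blast
    qed (auto simp: prefix_rel_iff n prefix_length_le)
  qed
  moreover have "(u, v) \<in> prefix_rel \<longleftrightarrow> length u \<le> length v"
    if "(u, w) \<in> prefix_rel" "(v, w) \<in> prefix_rel" for u v
    using that prefix_binary_words prefix_length_le prefix_length_prefix
    unfolding prefix_rel_iff by blast
  ultimately show "height_is prefix_rel w n"
    by (auto simp: height_is_def)
qed

lemma tree_height_prefix_rel [simp]: "w \<in> binary_words \<Longrightarrow> tree_height prefix_rel w = length w"
  by (simp add: tree_height_def height_is_prefix_rel)

lemma rooted_tree_binary_words: "rooted_tree binary_words prefix_rel"
proof -
  have "refl_on binary_words prefix_rel"
    by (auto simp: refl_on_def prefix_rel_iff)
  moreover have "trans prefix_rel"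
    unfolding trans_def prefix_rel_iff using prefix_order.trans by blast
  moreover have "antisym prefix_rel"
    by (auto simp: antisym_def prefix_rel_iff)
  moreover have "prefix_rel \<subseteq> binary_words \<times> binary_words"
    using prefix_binary_words by (fastforce simp: prefix_rel_iff)
  ultimately have "partial_order_on binary_words prefix_rel"
    by (simp add: partial_order_on_def preorder_on_def)
  moreover have "\<forall>w\<in>binary_words. ([], w) \<in> prefix_rel"
    by (simp add: prefix_rel_iff)
  ultimately show ?thesis
    unfolding rooted_tree_def by (metis Nil_binary_words height_is_prefix_rel)
qed

lemma tree_root_prefix_rel [simp]: "tree_root binary_words prefix_rel = []"
  unfolding tree_root_def
proof (rule the_equality)
  fix z assume "z \<in> binary_words \<and> (\<forall>w\<in>binary_words. (z, w) \<in> prefix_rel)"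
  then have "(z, []) \<in> prefix_rel" by auto
  then show "z = []" by (simp add: prefix_rel_iff)
qed (simp add: prefix_rel_iff)

lemma tree_succs_prefix_rel:
  assumes "w \<in> binary_words"
  shows "tree_succs prefix_rel w = {w @ [0], w @ [1]}"
proof (intro set_eqI iffI)
  fix v assume "v \<in> tree_succs prefix_rel w"
  then have v: "v \<in> binary_words" "prefix w v" "length v = length w + 1"
    using assms by (auto simp: tree_succs_def prefix_rel_iff)
  then obtain u where u: "v = w @ u" "length u = 1"
    by (auto simp: prefix_def)
  then obtain i where "u = [i]"
    by (auto simp: length_Suc_conv)
  with u v show "v \<in> {w @ [0], w @ [1]}" by auto
next
  fix v assume "v \<in> {w @ [0], w @ [1]}"
  then show "v \<in> tree_succs prefix_rel w"
    using assms by (auto simp: tree_succs_def prefix_rel_iff)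
qed

lemma pruned_binary_words: "pruned_finitely_splitting_tree binary_words prefix_rel"
  by (simp add: pruned_finitely_splitting_tree_def rooted_tree_binary_words tree_succs_prefix_rel)

lemma tree_restrict_prefix_rel:
  assumes "w \<in> binary_words" "k \<le> length w"
  shows "tree_restrict prefix_rel w k = take k w"
  unfolding tree_restrict_def
proof (rule the_equality)
  show "(take k w, w) \<in> prefix_rel \<and> tree_height prefix_rel (take k w) = k"
    using assms by (simp add: prefix_rel_iff take_is_prefix)
  fix v assume "(v, w) \<in> prefix_rel \<and> tree_height prefix_rel v = k"
  then have "prefix v w" "length v = k"
    using prefix_binary_words[of v w] by (auto simp: prefix_rel_iff)
  then show "v = take k w"
    by (auto simp: prefix_def)
qed

lemma tree_boundary_binary_words:
  assumes "\<omega> \<in> tree_boundary binary_words prefix_rel"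
  shows "\<omega> n \<in> binary_words" "length (\<omega> n) = n" "m \<le> n \<Longrightarrow> take m (\<omega> n) = \<omega> m"
proof -
  have *: "\<omega> n \<in> binary_words \<and> length (\<omega> n) = n" for n
  proof (induction n)
    case 0
    then show ?case using assms by (simp add: tree_boundary_def)
  next
    case (Suc n)
    have "\<omega> (Suc n) \<in> tree_succs prefix_rel (\<omega> n)"
      using assms by (simp add: tree_boundary_def)
    with Suc show ?case by (auto simp: tree_succs_prefix_rel)
  qed
  then show "\<omega> n \<in> binary_words" "length (\<omega> n) = n" by auto
  show "take m (\<omega> n) = \<omega> m" if "m \<le> n"
    using that
  proof (induction n rule: dec_induct)
    case (step n)
    have "\<omega> (Suc n) \<in> tree_succs prefix_rel (\<omega> n)"
      using assms by (simp add: tree_boundary_def)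
    with step show ?case using *[of n] by (auto simp: tree_succs_prefix_rel)
  qed (simp add: *)
qed

section \<open>Maximal antichains of the truncated binary tree\<close>

lemma antichain_prefix_relI:
  assumes "\<And>u w. u \<in> A \<Longrightarrow> w \<in> A \<Longrightarrow> prefix u w \<Longrightarrow> u = w"
  shows "antichain prefix_rel A"
  using assms unfolding antichain_def prefix_rel_iff by metis

lemma maximal_antichainD:
  assumes "maximal_antichain (tree_upto binary_words prefix_rel n - {[]}) prefix_rel A" "a \<in> A"
  shows "a \<in> binary_words" "length a \<le> n" "a \<noteq> []"
proof -
  have "a \<in> tree_upto binary_words prefix_rel n - {[]}"
    using assms unfolding maximal_antichain_def by blast
  then show "a \<in> binary_words" "length a \<le> n" "a \<noteq> []"
    by (auto simp: tree_upto_def)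
qed

text \<open>
Within \<open>T\<^sup>(\<^sup>\<le>\<^sup>n\<^sup>)\<close> nothing lies above a word of length \<open>n\<close>, so an element of the antichain that is
comparable to such a word is a prefix of it; without such an element the word could be added.
\<close>

lemma maximal_antichain_hits_words:
  assumes A: "maximal_antichain (tree_upto binary_words prefix_rel n - {[]}) prefix_rel A"
    and w: "w \<in> binary_words" "length w = n" "1 \<le> n"
  shows "\<exists>a\<in>A. prefix a w"
proof (rule ccontr)
  assume none: "\<not> (\<exists>a\<in>A. prefix a w)"
  let ?P = "tree_upto binary_words prefix_rel n - {[]}"
  have P: "a \<in> binary_words" "length a \<le> n" if "a \<in> A" for a
    using maximal_antichainD[OF A that] by auto
  have "w = a" if "a \<in> A" "prefix w a" for a
    using P[OF that(1)] that(2) w by (auto simp: prefix_def)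
  with none have inc: "\<not> prefix w a" "\<not> prefix a w" if "a \<in> A" for a
    using that by auto
  have "insert w A \<subseteq> ?P"
    using maximal_antichainD[OF A] w by (auto simp: tree_upto_def)
  moreover have "antichain prefix_rel (insert w A)"
    using A inc unfolding maximal_antichain_def antichain_def prefix_rel_iff by blast
  ultimately have "A = insert w A"
    using A unfolding maximal_antichain_def by blast
  with none show False by auto
qed

text \<open>
The converse criterion. The words of a single length \<open>L\<close> suffice, because every word \<open>b\<close>
and some word of length \<open>L\<close> are prefixes of a common word (pad \<open>b\<close> with zeros), and two prefixes of
one word are comparable.
\<close>

lemma maximal_antichainI:
  assumes A: "A \<subseteq> tree_upto binary_words prefix_rel n - {[]}" "antichain prefix_rel A"
    and hits: "\<And>w. w \<in> binary_words \<Longrightarrow> length w = L \<Longrightarrow> \<exists>a\<in>A. prefix a w"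
  shows "maximal_antichain (tree_upto binary_words prefix_rel n - {[]}) prefix_rel A"
  unfolding maximal_antichain_def
proof (intro conjI allI impI)
  fix B assume B: "B \<subseteq> tree_upto binary_words prefix_rel n - {[]}" "antichain prefix_rel B" "A \<subseteq> B"
  have "b \<in> A" if "b \<in> B" for b
  proof -
    have b: "b \<in> binary_words" using that B by (auto simp: tree_upto_def)
    let ?w = "b @ replicate L 0"
    have "take L ?w \<in> binary_words" "length (take L ?w) = L"
      using b by auto
    then obtain a where a: "a \<in> A" "prefix a (take L ?w)"
      using hits by blast
    then have "prefix a ?w"
      using take_is_prefix prefix_order.trans by blast
    moreover have "prefix b ?w" by simp
    ultimately have "prefix a b \<or> prefix b a"
      by (rule prefix_same_cases)
    moreover have "a \<in> binary_words" using a A by (auto simp: tree_upto_def)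
    ultimately have "(a, b) \<in> prefix_rel \<or> (b, a) \<in> prefix_rel"
      using b by (auto simp: prefix_rel_iff)
    moreover have "a \<in> B" using a B by auto
    ultimately have "a = b" using B(2) that by (auto simp: antichain_def)
    with a show ?thesis by simp
  qed
  with B show "A = B" by auto
qed (use A in auto)

text \<open>
This makes the antichain pressure non-increasing in \<open>n\<close>. For \<open>n = 0\<close> the claim fails: the
empty antichain is maximal there.
\<close>

lemma maximal_antichain_mono:
  assumes "1 \<le> n" "maximal_antichain (tree_upto binary_words prefix_rel n - {[]}) prefix_rel A"
  shows "maximal_antichain (tree_upto binary_words prefix_rel (Suc n) - {[]}) prefix_rel A"
proof (rule maximal_antichainI)
  show "A \<subseteq> tree_upto binary_words prefix_rel (Suc n) - {[]}"
    using maximal_antichainD[OF assms(2)] by (fastforce simp: tree_upto_def)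
  show "antichain prefix_rel A"
    using assms(2) by (simp add: maximal_antichain_def)
qed (use maximal_antichain_hits_words[OF assms(2) _ _ assms(1)] in blast)

text \<open>
Kraft's inequality, in the direction that holds for sets of words that meet every branch: each of the
\<open>2\<^sup>n\<close> words of length \<open>n\<close> extends some \<open>a \<in> A\<close>, and \<open>a\<close> has \<open>2\<^sup>n\<^sup>-\<^sup>|\<^sup>a\<^sup>|\<close> such extensions.
\<close>

lemma sum_half_power_maximal_antichain:
  assumes A: "maximal_antichain (tree_upto binary_words prefix_rel n - {[]}) prefix_rel A"
    and n: "1 \<le> n"
  shows "1 \<le> (\<Sum>a\<in>A. (1 / 2 :: real) ^ length a)"
proof -
  have P: "a \<in> binary_words" "length a \<le> n" if "a \<in> A" for a
    using maximal_antichainD[OF A that] by auto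
  let ?E = "\<lambda>a. {w \<in> binary_words. length w = n \<and> prefix a w}"
  have fin: "finite A"
  proof (rule finite_subset)
    show "A \<subseteq> (\<Union>k\<le>n. {w \<in> binary_words. length w = k})" using P by auto
  qed (simp add: finite_binary_words_length)
  have "{w \<in> binary_words. length w = n} \<subseteq> (\<Union>a\<in>A. ?E a)"
    using maximal_antichain_hits_words[OF A _ _ n] by blast
  then have "card {w \<in> binary_words. length w = n} \<le> card (\<Union>a\<in>A. ?E a)"
  proof (rule card_mono[rotated])
    have "(\<Union>a\<in>A. ?E a) \<subseteq> {w \<in> binary_words. length w = n}" by auto
    then show "finite (\<Union>a\<in>A. ?E a)"
      using finite_binary_words_length finite_subset by blast
  qed
  also have "\<dots> \<le> (\<Sum>a\<in>A. card (?E a))"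
    by (rule card_UN_le[OF fin])
  also have "\<dots> = (\<Sum>a\<in>A. 2 ^ (n - length a))"
    using P by (intro sum.cong) (auto simp: card_binary_words_extending)
  finally have "(2::nat) ^ n \<le> (\<Sum>a\<in>A. 2 ^ (n - length a))"
    by (simp add: card_binary_words_length)
  then have "real (2 ^ n) \<le> real (\<Sum>a\<in>A. 2 ^ (n - length a))"
    by (simp only: of_nat_le_iff)
  also have "\<dots> = (\<Sum>a\<in>A. 2 ^ n * (1 / 2) ^ length a)"
    unfolding of_nat_sum
  proof (intro sum.cong refl)
    fix a assume "a \<in> A"
    then have "(2::real) ^ n = 2 ^ (n - length a) * 2 ^ length a"
      using P by (simp flip: power_add)
    then show "real (2 ^ (n - length a)) = 2 ^ n * (1 / 2) ^ length a"
      by (simp add: power_divide)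
  qed
  also have "\<dots> = 2 ^ n * (\<Sum>a\<in>A. (1 / 2) ^ length a)"
    by (simp add: sum_distrib_left)
  finally show ?thesis by simp
qed

section \<open>Contraction ratios\<close>

definition leading_zeros :: "nat list \<Rightarrow> nat"
  where "leading_zeros w = length (takeWhile (\<lambda>i. i = 0) w)"

text \<open>
The ratio of the map \<open>\<phi>\<^sub>w\<close>. Above \<open>0\<^sup>k1\<close> the dyadic regime lasts up to level \<open>(k + 1)\<^sup>2\<close>, after which the
triadic one takes over. The bound is at least \<open>k + 1\<close>, so that the spine \<open>0, 00, 000, \<dots>\<close> is
dyadic throughout, and it grows faster than linearly in \<open>k\<close>, so that at level \<open>n\<close> the dyadic regime is
still found above a spine node of height \<open>o(n)\<close>.
\<close>

definition ratio :: "nat list \<Rightarrow> real"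
  where "ratio w = (if length w \<le> (leading_zeros w + 1)\<^sup>2 then 1 / 2 else 1 / 3)"

definition contraction :: "nat list \<Rightarrow> real"
  where "contraction w = (\<Prod>k=1..length w. ratio (take k w))"

lemma leading_zeros_append:
  "leading_zeros (u @ w) =
    (if leading_zeros u = length u then length u + leading_zeros w else leading_zeros u)"
proof (induction u)
  case (Cons i u)
  then show ?case by (auto simp: leading_zeros_def split: if_splits)
qed (simp add: leading_zeros_def)

lemma leading_zeros_replicate [simp]: "leading_zeros (replicate n 0) = n"
  by (simp add: leading_zeros_def)

lemma leading_zeros_Cons_1 [simp]: "leading_zeros (Suc 0 # w) = 0"
  by (simp add: leading_zeros_def)

lemma prefix_replicate_iff_leading_zeros: "prefix (replicate n 0) w \<longleftrightarrow> n \<le> leading_zeros w"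
proof (induction n arbitrary: w)
  case (Suc n)
  then show ?case by (cases w) (auto simp: leading_zeros_def)
qed simp

lemma ratio_pos: "0 < ratio w" and ratio_le: "ratio w \<le> 1 / 2" and ratio_ge: "1 / 3 \<le> ratio w"
  by (auto simp: ratio_def)

lemma contraction_Nil [simp]: "contraction [] = 1"
  by (simp add: contraction_def)

lemma contraction_snoc [simp]: "contraction (w @ [i]) = contraction w * ratio (w @ [i])"
proof -
  have "(\<Prod>k=1..length w. ratio (take k (w @ [i]))) = (\<Prod>k=1..length w. ratio (take k w))"
    by (intro prod.cong) auto
  then show ?thesis
    by (simp add: contraction_def)
qed

lemma contraction_pos: "0 < contraction w"
  by (simp add: contraction_def ratio_pos prod_pos)

lemma contraction_le: "contraction w \<le> (1 / 2) ^ length w"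
proof (induction w rule: rev_induct)
  case (snoc i w)
  then show ?case
    using mult_mono[OF snoc ratio_le[of "w @ [i]"]] ratio_pos[of "w @ [i]"] by simp
qed simp

lemma contraction_ge: "(1 / 3) ^ length w \<le> contraction w"
proof (induction w rule: rev_induct)
  case (snoc i w)
  then show ?case
    using mult_mono[OF snoc ratio_ge[of "w @ [i]"]] contraction_pos[of w] by simp
qed simp

lemma contraction_le_1: "contraction w \<le> 1"
  using contraction_le[of w] power_le_one[of "1 / 2 :: real" "length w"] by simp

text \<open>
If the last map is dyadic, so are all earlier ones: a prefix either consists of zeros
only or has the same number of leading zeros as the whole word.
\<close>

lemma contraction_eq_half_power:
  assumes "length w \<le> (leading_zeros w + 1)\<^sup>2"
  shows "contraction w = (1 / 2) ^ length w"
proof -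
  have "ratio (take k w) = 1 / 2" if "k \<le> length w" for k
  proof -
    have "length (take k w) \<le> (leading_zeros (take k w) + 1)\<^sup>2"
    proof (cases "leading_zeros (take k w) = length (take k w)")
      case True
      then show ?thesis by (simp add: power2_eq_square)
    next
      case False
      then have "leading_zeros w = leading_zeros (take k w)"
        using leading_zeros_append[of "take k w" "drop k w"] by simp
      then show ?thesis using assms by simp
    qed
    then show ?thesis by (simp add: ratio_def)
  qed
  then have "contraction w = (\<Prod>k=1..length w. 1 / 2)"
    unfolding contraction_def by (intro prod.cong) auto
  then show ?thesis by simp
qed

text \<open>
Beyond level \<open>M\<^sup>2\<close> every map of such a word is triadic, and each earlier factor is at most \<open>1\<close>.
\<close>

lemma contraction_le_third_power:
  assumes "leading_zeros w < M"
  shows "contraction w \<le> (1 / 3) ^ (length w - M\<^sup>2)"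
  using assms
proof (induction w rule: rev_induct)
  case (snoc i w)
  show ?case
  proof (cases "length (w @ [i]) \<le> M\<^sup>2")
    case True
    then show ?thesis using contraction_le_1[of "w @ [i]"] by simp
  next
    case False
    have "(leading_zeros (w @ [i]) + 1)\<^sup>2 \<le> M\<^sup>2"
      using snoc.prems by (intro power_mono) auto
    with False have "\<not> length (w @ [i]) \<le> (leading_zeros (w @ [i]) + 1)\<^sup>2"
      by linarith
    then have "ratio (w @ [i]) = 1 / 3"
      by (simp only: ratio_def if_False)
    moreover have "leading_zeros w \<le> leading_zeros (w @ [i])"
      using leading_zeros_append[of w "[i]"] by simp
    then have "contraction w \<le> (1 / 3) ^ (length w - M\<^sup>2)"
      using snoc by simp
    moreover have "length (w @ [i]) - M\<^sup>2 = Suc (length w - M\<^sup>2)"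
      using False by (simp add: Suc_diff_le)
    ultimately show ?thesis
      by (simp only: contraction_snoc power_Suc)
  qed
qed simp

text \<open>
The subtree above \<open>1\<close> is triadic from its first level on, so it carries a scaled copy of the
middle-third Cantor set.
\<close>

lemma contraction_Cons_1: "contraction (1 # w) = (1 / 2) * (1 / 3) ^ length w"
proof (induction w rule: rev_induct)
  case Nil
  have "ratio [1] = 1 / 2" by (simp add: ratio_def)
  then show ?case by (simp add: contraction_def)
next
  case (snoc i w)
  have "ratio (1 # w @ [i]) = 1 / 3"
    by (simp add: ratio_def)
  then have "contraction (1 # w @ [i]) = contraction (1 # w) * (1 / 3)"
    using contraction_snoc[of "1 # w" i] by simp
  with snoc show ?case by simp
qed

section \<open>Antichains that cut the tree along the spine\<close>

text \<open>
The spine is cut at level \<open>M\<close>; the finitely many subtrees that have left it before are cut at a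
common level \<open>L\<close>, to be chosen so large that all of them have long been triadic.
\<close>

definition spine_cut :: "nat \<Rightarrow> nat \<Rightarrow> nat list set"
  where "spine_cut M L =
    insert (replicate M 0) {w \<in> binary_words. length w = L \<and> leading_zeros w < M}"

lemma spine_cut_hits_words:
  assumes "w \<in> binary_words" "length w = L"
  shows "\<exists>a\<in>spine_cut M L. prefix a w"
proof (cases "leading_zeros w < M")
  case True
  with assms have "w \<in> spine_cut M L" by (simp add: spine_cut_def)
  then show ?thesis by blast
next
  case False
  then have "prefix (replicate M 0) w"
    by (simp add: prefix_replicate_iff_leading_zeros)
  moreover have "replicate M 0 \<in> spine_cut M L" by (simp add: spine_cut_def)
  ultimately show ?thesis by blast
qed

lemma maximal_antichain_spine_cut:
  assumes "1 \<le> M" "M \<le> L" "L \<le> n"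
  shows "maximal_antichain (tree_upto binary_words prefix_rel n - {[]}) prefix_rel (spine_cut M L)"
proof (rule maximal_antichainI)
  show "spine_cut M L \<subseteq> tree_upto binary_words prefix_rel n - {[]}"
    using assms by (auto simp: spine_cut_def tree_upto_def)
  show "antichain prefix_rel (spine_cut M L)"
  proof (rule antichain_prefix_relI)
    fix u w assume uw: "u \<in> spine_cut M L" "w \<in> spine_cut M L" "prefix u w"
    then have "length u \<le> length w" by (simp add: prefix_length_le)
    then have "length u = length w"
      using uw assms prefix_replicate_iff_leading_zeros[of M w] by (auto simp: spine_cut_def)
    with uw show "u = w" by (auto simp: prefix_def)
  qed
qed (rule spine_cut_hits_words)

lemma finite_spine_cut: "finite (spine_cut M L)"
  by (rule finite_subset[OF _ finite.insertI[OF finite_binary_words_length[of L]]])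
    (auto simp: spine_cut_def)

lemma sum_spine_cut_le:
  assumes t: "0 \<le> t" and le_L: "M\<^sup>2 \<le> L"
  shows "(\<Sum>w\<in>spine_cut M L. contraction w powr t)
    \<le> (1 / 2) powr (t * real M) + 3 powr (t * real (M\<^sup>2)) * (2 / 3 powr t) ^ L"
proof -
  let ?B = "{w \<in> binary_words. length w = L \<and> leading_zeros w < M}"
  have finB: "finite ?B"
    by (rule finite_subset[OF _ finite_binary_words_length[of L]]) auto
  have "(\<Sum>w\<in>spine_cut M L. contraction w powr t) = contraction (replicate M 0) powr t + (\<Sum>w\<in>?B. contraction w powr t)"
    using finB by (simp add: spine_cut_def)
  also have "contraction (replicate M 0) powr t \<le> ((1 / 2) ^ M) powr t"
    using contraction_le[of "replicate M 0"] contraction_pos[of "replicate M 0"] t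
    by (intro powr_mono2) auto
  also have "((1 / 2) ^ M) powr t = (1 / 2 :: real) powr (t * real M)"
    by (simp add: powr_powr mult.commute flip: powr_realpow)
  also have "(\<Sum>w\<in>?B. contraction w powr t) \<le> (\<Sum>w\<in>?B. ((1 / 3) ^ (L - M\<^sup>2)) powr t)"
  proof (rule sum_mono)
    fix w assume "w \<in> ?B"
    then show "contraction w powr t \<le> ((1 / 3) ^ (L - M\<^sup>2)) powr t"
      using contraction_le_third_power[of w M] contraction_pos[of w] t by (intro powr_mono2) auto
  qed
  also have "\<dots> = real (card ?B) * ((1 / 3) ^ (L - M\<^sup>2)) powr t"
    by simp
  also have "\<dots> \<le> 2 ^ L * ((1 / 3) ^ (L - M\<^sup>2)) powr t"
  proof (rule mult_right_mono)
    have "card ?B \<le> 2 ^ L"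
      unfolding card_binary_words_length[symmetric]
      by (rule card_mono[OF finite_binary_words_length]) auto
    then show "real (card ?B) \<le> 2 ^ L"
      by (metis of_nat_le_iff of_nat_numeral of_nat_power)
  qed simp
  also have "((1 / 3) ^ (L - M\<^sup>2)) powr t = 3 powr (t * real (M\<^sup>2)) / (3 powr t) ^ L"
  proof -
    have "((1 / 3 :: real) ^ (L - M\<^sup>2)) powr t = (1 / 3) powr (t * real (L - M\<^sup>2))"
      by (simp add: powr_powr mult.commute flip: powr_realpow)
    also have "\<dots> = 3 powr (t * real (M\<^sup>2) - t * real L)"
      using le_L by (simp add: powr_divide of_nat_diff algebra_simps flip: powr_minus_divide)
    also have "\<dots> = 3 powr (t * real (M\<^sup>2)) / (3 powr t) ^ L"
      by (simp add: powr_diff powr_powr flip: powr_realpow)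
    finally show ?thesis .
  qed
  finally show ?thesis
    by (simp add: power_divide mult_ac)
qed

text \<open>
The exponent is supercritical exactly when \<open>2 < 3\<^sup>t\<close>, and then the contribution of the words of
length \<open>L\<close> vanishes as \<open>L\<close> grows with \<open>M\<close> fixed.
\<close>

lemma exists_spine_cut_small:
  fixes t \<epsilon> :: real
  assumes t: "ln 2 / ln 3 < t" and \<epsilon>: "0 < \<epsilon>"
  shows "\<exists>L\<ge>M. (\<Sum>w\<in>spine_cut M L. contraction w powr t) < (1 / 2) powr (t * real M) + \<epsilon>"
proof -
  have t0: "0 < t" using t by (smt (verit) divide_pos_pos ln_gt_zero)
  have "ln 2 < ln 3 * t" using t by (simp add: field_simps)
  then have "exp (ln 2) < exp (ln 3 * t)" by (subst exp_less_cancel_iff)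
  then have "(2::real) < 3 powr t" by (simp add: powr_def mult.commute)
  then have "(\<lambda>L. (2 / 3 powr t) ^ L) \<longlonglongrightarrow> 0"
    by (intro LIMSEQ_power_zero) auto
  then have "(\<lambda>L. 3 powr (t * real (M\<^sup>2)) * (2 / 3 powr t) ^ L) \<longlonglongrightarrow> 0"
    by (rule tendsto_mult_right_zero)
  then have "\<forall>\<^sub>F L in sequentially. 3 powr (t * real (M\<^sup>2)) * (2 / 3 powr t) ^ L < \<epsilon>"
    using \<epsilon> by (rule order_tendstoD(2))
  then obtain L0 where L0: "\<And>L. L \<ge> L0 \<Longrightarrow> 3 powr (t * real (M\<^sup>2)) * (2 / 3 powr t) ^ L < \<epsilon>"
    by (auto simp: eventually_sequentially)
  \<comment> \<open>By level \<open>M\<^sup>2\<close> all subtrees that left the spine before level \<open>M\<close> have become triadic.\<close>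
  define L where "L = max L0 (M\<^sup>2)"
  have "M \<le> M\<^sup>2" by (simp add: power2_eq_square)
  then have "M \<le> L" by (simp add: L_def)
  moreover have "(\<Sum>w\<in>spine_cut M L. contraction w powr t) < (1 / 2) powr (t * real M) + \<epsilon>"
    using sum_spine_cut_le[of t M L] L0[of L] t0 by (simp add: L_def)
  ultimately show ?thesis by blast
qed

lemma exists_spine_cut_sum_less:
  fixes t \<epsilon> \<delta> :: real
  assumes t: "ln 2 / ln 3 < t" and \<epsilon>: "0 < \<epsilon>" and \<delta>: "0 < \<delta>"
  obtains M L where "1 \<le> M" "M \<le> L" "(1 / 2) ^ M < \<delta>" "(\<Sum>w\<in>spine_cut M L. contraction w powr t) < \<epsilon>"
proof -
  have t0: "0 < t" using t by (smt (verit) divide_pos_pos ln_gt_zero)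
  have "(\<lambda>M. ((1 / 2) powr t) ^ M) \<longlonglongrightarrow> (0::real)"
    using t0 powr_less_mono'[of "1 / 2" 0 t] by (intro LIMSEQ_power_zero) auto
  moreover have "(\<lambda>M. (1 / 2) ^ M) \<longlonglongrightarrow> (0::real)"
    by (intro LIMSEQ_power_zero) auto
  ultimately have "\<forall>\<^sub>F M in sequentially. ((1 / 2) powr t) ^ M < \<epsilon> / 2 \<and> (1 / 2) ^ M < \<delta> \<and> 1 \<le> M"
    using \<epsilon> \<delta> by (intro eventually_conj order_tendstoD(2)[where y = 0] eventually_ge_at_top) auto
  then obtain M where M: "((1 / 2) powr t) ^ M < \<epsilon> / 2" "(1 / 2) ^ M < \<delta>" "1 \<le> M"
    by (auto simp: eventually_sequentially)
  obtain L where L: "L \<ge> M" "(\<Sum>w\<in>spine_cut M L. contraction w powr t) < (1 / 2) powr (t * real M) + \<epsilon> / 2"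
    using exists_spine_cut_small[OF t, of "\<epsilon> / 2" M] \<epsilon> by auto
  have "(1 / 2) powr (t * real M) = ((1 / 2) powr t) ^ M"
    by (simp add: powr_powr flip: powr_realpow)
  with M L show ?thesis by (intro that[of M L]) auto
qed

section \<open>The line inside the space of finitely supported sequences\<close>

definition axis_point :: "real \<Rightarrow> nat \<Rightarrow>\<^sub>0 real"
  where "axis_point x = Poly_Mapping.single 0 x"

lemma axis_point_add: "axis_point (x + y) = axis_point x + axis_point y"
  by (simp add: axis_point_def single_add)

lemma axis_point_scaleR: "axis_point (c * x) = c *\<^sub>R axis_point x"
  by (rule poly_mapping_eqI) (simp add: axis_point_def lookup_single when_def)

lemma axis_point_0 [simp]: "axis_point 0 = 0"
  by (simp add: axis_point_def)

lemma axis_point_diff: "axis_point (x - y) = axis_point x - axis_point y"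
  by (simp add: axis_point_def single_diff)

lemma inner_axis_point [simp]: "axis_point x \<bullet> axis_point y = x * y"
  by (simp add: inner_poly_mapping_superset[where S = "{0}"] axis_point_def)

lemma norm_axis_point [simp]: "norm (axis_point x) = \<bar>x\<bar>"
  by (simp add: norm_eq_sqrt_inner)

lemma dist_axis_point [simp]: "dist (axis_point x) (axis_point y) = \<bar>x - y\<bar>"
  by (simp add: dist_norm flip: axis_point_diff)

lemma axis_point_eq_iff [simp]: "axis_point x = axis_point y \<longleftrightarrow> x = y"
  using dist_axis_point[of x y] by (auto simp del: dist_axis_point)

lemma euclid_1_eq: "euclid 1 = range axis_point"
proof (intro set_eqI iffI)
  fix v assume "v \<in> euclid 1"
  then have "Poly_Mapping.lookup v i = 0" if "i \<noteq> 0" for i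
    using that by (auto simp: euclid_def in_keys_iff subset_iff)
  then have "v = axis_point (Poly_Mapping.lookup v 0)"
    by (intro poly_mapping_eqI) (auto simp: axis_point_def lookup_single when_def)
  then show "v \<in> range axis_point" by blast
qed (auto simp: euclid_def axis_point_def split: if_splits)

lemma subspace_range_axis_point: "subspace (range axis_point)"
  using subspace_euclid[of 1] by (simp only: euclid_1_eq)

lemma homeomorphic_map_axis_point: "homeomorphic_map euclidean (top_of_set (range axis_point)) axis_point"
proof -
  have "continuous_on UNIV axis_point"
    by (rule continuous_on_iff[THEN iffD2]) (auto simp: dist_real_def)
  moreover have "continuous_on (range axis_point) (\<lambda>v. v \<bullet> axis_point 1)"
    by (intro continuous_intros)
  ultimately have "homeomorphic_maps euclidean (top_of_set (range axis_point)) axis_point (\<lambda>v. v \<bullet> axis_point 1)"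
    by (auto simp: homeomorphic_maps_def continuous_map_in_subtopology)
  then show ?thesis
    using homeomorphic_maps_map by blast
qed

lemma interior_of_axis_point: "top_of_set (range axis_point) interior_of (axis_point ` A) = axis_point ` interior A"
  using homeomorphic_map_interior_of[OF homeomorphic_map_axis_point, of A] by simp

lemma frontier_of_axis_point: "top_of_set (range axis_point) frontier_of (axis_point ` A) = axis_point ` frontier A"
  using homeomorphic_map_frontier_of[OF homeomorphic_map_axis_point, of A] by simp

section \<open>Similarities on a subspace\<close>

text \<open>
The derivative within \<open>E\<close> is determined only along \<open>E\<close>. There it is found by
restricting the function to the lines \<open>t \<mapsto> x + t h\<close>, for which derivatives are unique.
\<close>

lemma has_derivative_within_subspace_unique:
  assumes E: "subspace E" "x \<in> E" "h \<in> E"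
    and f: "(f has_derivative F) (at x within E)" "(f has_derivative G) (at x within E)"
  shows "F h = G h"
proof -
  have line: "((\<lambda>t. x + t *\<^sub>R h) has_derivative (\<lambda>t. t *\<^sub>R h)) (at 0)"
    by (auto intro!: derivative_eq_intros)
  have img: "range (\<lambda>t. x + t *\<^sub>R h) \<subseteq> E"
    using E by (auto intro: subspace_add subspace_scale)
  have "((\<lambda>t. f (x + t *\<^sub>R h)) has_derivative (\<lambda>t. H (t *\<^sub>R h))) (at 0)"
    if "(f has_derivative H) (at x within E)" for H
    using that img by (intro has_derivative_in_compose[OF line]) (auto intro: has_derivative_subset)
  from this[OF f(1)] this[OF f(2)] have "(\<lambda>t. F (t *\<^sub>R h)) = (\<lambda>t. G (t *\<^sub>R h))"
    by (rule has_derivative_unique)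
  then show ?thesis
    by (auto dest: fun_cong[where x = 1])
qed

lemma deriv_norm_similarity:
  assumes "subspace E" "x \<in> E" "e \<in> E" "e \<noteq> 0" "0 \<le> c"
  shows "deriv_norm E (\<lambda>v. c *\<^sub>R v + b) x = c"
proof -
  have der: "((\<lambda>v. c *\<^sub>R v + b) has_derivative (\<lambda>h. c *\<^sub>R h)) (at x within E)"
    by (auto intro!: derivative_eq_intros)
  then have "((\<lambda>v. c *\<^sub>R v + b) has_derivative
      frechet_derivative (\<lambda>v. c *\<^sub>R v + b) (at x within E)) (at x within E)"
    using differentiableI frechet_derivative_works by blast
  then have *: "frechet_derivative (\<lambda>v. c *\<^sub>R v + b) (at x within E) h = c *\<^sub>R h" if "h \<in> E" for h
    using has_derivative_within_subspace_unique[OF assms(1,2) that _ der] by blast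
  have "deriv_norm E (\<lambda>v. c *\<^sub>R v + b) x = (SUP h\<in>E. norm (c *\<^sub>R h) / norm h)"
    unfolding deriv_norm_def by (intro SUP_cong) (simp_all add: *)
  also have "\<dots> = c"
  proof (rule cSup_eq_maximum)
    \<comment> \<open>The quotient is \<open>0\<close> at \<open>h = 0\<close>, so a nonzero vector is needed for the supremum.\<close>
    show "c \<in> (\<lambda>h. norm (c *\<^sub>R h) / norm h) ` E"
      using assms by (intro image_eqI[of _ _ e]) auto
    show "y \<le> c" if "y \<in> (\<lambda>h. norm (c *\<^sub>R h) / norm h) ` E" for y
      using that assms by auto
  qed
  finally show ?thesis .
qed

lemma similarity_image_subspace:
  assumes "subspace E" "b \<in> E" "c \<noteq> 0"
  shows "(\<lambda>v. c *\<^sub>R v + b) ` E = E"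
proof
  show "(\<lambda>v. c *\<^sub>R v + b) ` E \<subseteq> E"
    using assms by (auto intro: subspace_add subspace_scale)
  show "E \<subseteq> (\<lambda>v. c *\<^sub>R v + b) ` E"
  proof
    fix w assume "w \<in> E"
    then have "(1 / c) *\<^sub>R (w - b) \<in> E"
      using assms by (intro subspace_scale subspace_diff)
    moreover have "w = c *\<^sub>R ((1 / c) *\<^sub>R (w - b)) + b"
      using assms by simp
    ultimately show "w \<in> (\<lambda>v. c *\<^sub>R v + b) ` E" by blast
  qed
qed

lemma C1_on_similarity: "C1_on E V (\<lambda>v. c *\<^sub>R v + b)"
  unfolding C1_on_def
proof (intro exI[of _ "\<lambda>_. c *\<^sub>R id_blinfun"] conjI ballI)
  fix x assume "x \<in> V"
  show "((\<lambda>v. c *\<^sub>R v + b) has_derivative blinfun_apply (c *\<^sub>R id_blinfun)) (at x within E)"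
    by (auto intro!: derivative_eq_intros simp: blinfun.scaleR_left)
qed (rule continuous_on_const)

lemma C1_diffeo_similarity:
  assumes "subspace E" "b \<in> E" "c \<noteq> 0"
  shows "C1_diffeo_onto_image E E (\<lambda>v. c *\<^sub>R v + b)"
proof -
  let ?f = "\<lambda>v. c *\<^sub>R v + b" and ?g = "\<lambda>w. (1 / c) *\<^sub>R w + (- (1 / c)) *\<^sub>R b"
  have inj: "inj_on ?f E"
    using assms by (auto simp: inj_on_def)
  have img: "?f ` E = E"
    using similarity_image_subspace[OF assms] .
  have inv: "inv_into E ?f w = ?g w" if "w \<in> E" for w
  proof (rule inv_into_f_eq[OF inj])
    show "?g w \<in> E" using assms that by (intro subspace_add subspace_scale)
    show "?f (?g w) = w" using assms by (simp add: algebra_simps)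
  qed
  obtain g' where g': "\<And>x. x \<in> E \<Longrightarrow> (?g has_derivative blinfun_apply (g' x)) (at x within E)"
      "continuous_on E g'"
    using C1_on_similarity[of E E "1 / c" "(- (1 / c)) *\<^sub>R b"] unfolding C1_on_def by blast
  have "C1_on E E (inv_into E ?f)"
    unfolding C1_on_def
    using g'(2) has_derivative_transform[OF _ inv g'(1)] by blast
  then show ?thesis
    unfolding C1_diffeo_onto_image_def using inj img C1_on_similarity by auto
qed

lemma conformal_on_similarity:
  assumes "c \<noteq> 0"
  shows "conformal_on E V (\<lambda>v. c *\<^sub>R v + b)"
  unfolding conformal_on_def
proof (intro ballI exI conjI)
  fix x assume "x \<in> V"
  show "((\<lambda>v. c *\<^sub>R v + b) has_derivative (\<lambda>h. c *\<^sub>R id h)) (at x within E)"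
    by (auto intro!: derivative_eq_intros)
qed (use assms in \<open>auto simp: orthogonal_transformation_id\<close>)

section \<open>The conformal tree iterated function system\<close>

text \<open>
On the line this is the similarity of the stated ratio that fixes \<open>0\<close> if the last letter of
\<open>w\<close> is \<open>0\<close> and fixes \<open>1\<close> if it is \<open>1\<close>. Siblings have equal ratios, so their intervals
touch if the ratio is \<open>1 / 2\<close> and leave out the middle third if it is \<open>1 / 3\<close>.
\<close>

definition branch :: "nat list \<Rightarrow> (nat \<Rightarrow>\<^sub>0 real) \<Rightarrow> (nat \<Rightarrow>\<^sub>0 real)"
  where "branch w = (\<lambda>v. ratio w *\<^sub>R v + axis_point ((1 - ratio w) * real (last w)))"

definition left_end :: "nat list \<Rightarrow> real"
  where "left_end w =
    (\<Sum>k<length w. contraction (take k w) * (1 - ratio (take (Suc k) w)) * real (w ! k))"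

definition cylinder :: "nat list \<Rightarrow> real set"
  where "cylinder w = {left_end w .. left_end w + contraction w}"

lemma branch_axis_point: "branch w (axis_point x) = axis_point (ratio w * x + (1 - ratio w) * real (last w))"
  by (simp add: branch_def axis_point_add axis_point_scaleR)

lemma left_end_Nil [simp]: "left_end [] = 0"
  by (simp add: left_end_def)

lemma left_end_snoc [simp]:
  "left_end (w @ [i]) = left_end w + contraction w * (1 - ratio (w @ [i])) * real i"
proof -
  have "(\<Sum>k<length w. contraction (take k (w @ [i])) * (1 - ratio (take (Suc k) (w @ [i])))
      * real ((w @ [i]) ! k)) = left_end w"
    unfolding left_end_def by (intro sum.cong) (auto simp: nth_append)
  then show ?thesis
    by (simp add: left_end_def)
qed

lemma tifs_comp_Nil [simp]: "tifs_comp prefix_rel \<phi> [] = id"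
  by (simp add: tifs_comp_def)

lemma foldr_comp_snoc: "foldr (\<circ>) (fs @ [g]) id = foldr (\<circ>) fs id \<circ> g"
  by (induction fs) (simp_all add: o_assoc del: foldr_append)

lemma tifs_comp_snoc:
  assumes "w @ [i] \<in> binary_words"
  shows "tifs_comp prefix_rel \<phi> (w @ [i]) = tifs_comp prefix_rel \<phi> w \<circ> \<phi> (w @ [i])"
proof -
  have w: "w \<in> binary_words" using assms by simp
  have init: "map (\<lambda>k. \<phi> (tree_restrict prefix_rel (w @ [i]) k)) [1..<Suc (length w)]
      = map (\<lambda>k. \<phi> (tree_restrict prefix_rel w k)) [1..<Suc (length w)]"
    using assms w by (intro map_cong refl) (simp add: tree_restrict_prefix_rel del: upt_Suc)
  have "[1..<Suc (length (w @ [i]))] = [1..<Suc (length w)] @ [length (w @ [i])]"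
    by simp
  then have "tifs_comp prefix_rel \<phi> (w @ [i]) = foldr (\<circ>)
      (map (\<lambda>k. \<phi> (tree_restrict prefix_rel w k)) [1..<Suc (length w)]
        @ [\<phi> (tree_restrict prefix_rel (w @ [i]) (length (w @ [i])))]) id"
    by (simp only: tifs_comp_def tree_height_prefix_rel[OF assms] map_append init list.map)
  also have "tree_restrict prefix_rel (w @ [i]) (length (w @ [i])) = w @ [i]"
    using assms by (simp only: tree_restrict_prefix_rel[OF assms order_refl] take_all_iff)
  finally show ?thesis
    by (simp only: foldr_comp_snoc tifs_comp_def tree_height_prefix_rel[OF w])
qed

lemma tifs_comp_branch:
  assumes "w \<in> binary_words"
  shows "tifs_comp prefix_rel branch w = (\<lambda>v. contraction w *\<^sub>R v + axis_point (left_end w))"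
  using assms
proof (induction w rule: rev_induct)
  case (snoc i w)
  show ?case
  proof
    fix v
    have "tifs_comp prefix_rel branch (w @ [i]) v
        = contraction w *\<^sub>R branch (w @ [i]) v + axis_point (left_end w)"
      using snoc by (simp only: tifs_comp_snoc o_apply append_binary_words_iff)
    also have "\<dots> = contraction (w @ [i]) *\<^sub>R v
        + axis_point (contraction w * ((1 - ratio (w @ [i])) * real i) + left_end w)"
      by (simp add: branch_def axis_point_add scaleR_add_right axis_point_scaleR)
    also have "contraction w * ((1 - ratio (w @ [i])) * real i) + left_end w = left_end (w @ [i])"
      by simp
    finally show "tifs_comp prefix_rel branch (w @ [i]) v
        = contraction (w @ [i]) *\<^sub>R v + axis_point (left_end (w @ [i]))" .
  qed
qed (auto simp: id_def)

lemma tifs_comp_image: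
  assumes "w \<in> binary_words"
  shows "tifs_comp prefix_rel branch w ` (axis_point ` {0..1}) = axis_point ` cylinder w"
proof -
  have "tifs_comp prefix_rel branch w (axis_point x) = axis_point (contraction w * x + left_end w)" for x
    by (simp add: tifs_comp_branch[OF assms] axis_point_add axis_point_scaleR)
  then have "tifs_comp prefix_rel branch w ` (axis_point ` {0..1})
      = axis_point ` ((\<lambda>x. contraction w * x + left_end w) ` {0..1})"
    by (simp add: image_image)
  moreover have "(\<lambda>x. contraction w * x + left_end w) ` {0..1} = cylinder w"
    using image_affinity_atLeastAtMost[of "contraction w" "left_end w" 0 1] contraction_pos[of w]
    by (simp add: cylinder_def add.commute[of "left_end w"])
  ultimately show ?thesis by simp
qed

lemma sup_deriv_norm_tifs_comp:
  assumes "w \<in> binary_words"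
  shows "sup_deriv_norm (range axis_point) (axis_point ` {0..1}) (tifs_comp prefix_rel branch w) = contraction w"
proof -
  have "deriv_norm (range axis_point) (tifs_comp prefix_rel branch w) x = contraction w"
    if "x \<in> axis_point ` {0..1}" for x
    unfolding tifs_comp_branch[OF assms]
  proof (rule deriv_norm_similarity[OF subspace_range_axis_point])
    show "axis_point 1 \<in> range axis_point" "x \<in> range axis_point" using that by auto
    show "axis_point 1 \<noteq> 0" using axis_point_eq_iff[of 1 0] by (simp del: axis_point_eq_iff)
  qed (use contraction_pos[of w] in simp)
  then show ?thesis by (simp add: sup_deriv_norm_def)
qed

lemma TIFS_branch: "TIFS (axis_point ` {0..1}) binary_words prefix_rel branch"
proof -
  have cont: "continuous_on A axis_point" for A
    by (rule continuous_on_iff[THEN iffD2]) (auto simp: dist_real_def)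
  have "branch w ` (axis_point ` {0..1}) \<subseteq> axis_point ` {0..1}" if "w \<in> binary_words" "w \<noteq> []" for w
  proof -
    have "last w = 0 \<or> last w = 1"
      using that last_in_set[of w] unfolding binary_words_def by blast
    then have "ratio w * x + (1 - ratio w) * real (last w) \<in> {0..1}" if "x \<in> {0..1}" for x
      using that ratio_pos[of w] ratio_le[of w] mult_mono[of "ratio w" 1 x 1]
        mult_left_mono[of x 1 "ratio w"] by auto
    then show ?thesis by (auto simp: branch_axis_point)
  qed
  moreover have "lipschitz_on (1 / 2) A (branch w)" for A w
  proof (rule lipschitz_onI)
    fix x y :: "nat \<Rightarrow>\<^sub>0 real"
    have "branch w x - branch w y = ratio w *\<^sub>R (x - y)"
      by (simp add: branch_def scaleR_diff_right)
    then have "dist (branch w x) (branch w y) = ratio w * dist x y"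
      using ratio_pos[of w] by (simp add: dist_norm)
    also have "\<dots> \<le> 1 / 2 * dist x y"
      by (intro mult_right_mono ratio_le) simp
    finally show "dist (branch w x) (branch w y) \<le> 1 / 2 * dist x y" .
  qed simp
  ultimately have "\<forall>w\<in>binary_words - {[]}.
      branch w ` (axis_point ` {0..1}) \<subseteq> axis_point ` {0..1} \<and> lipschitz_on (1 / 2) (axis_point ` {0..1}) (branch w)"
    by auto
  then have "\<exists>s. 0 < s \<and> s < 1 \<and> (\<forall>w\<in>binary_words - {[]}.
      branch w ` (axis_point ` {0..1}) \<subseteq> axis_point ` {0..1} \<and> lipschitz_on s (axis_point ` {0..1}) (branch w))"
    by (intro exI[of _ "1 / 2"]) auto
  then show ?thesis
    unfolding TIFS_def using pruned_binary_words
    by (simp add: compact_continuous_image connected_continuous_image cont)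
qed

lemma open_set_condition_branch:
  assumes "u \<in> tree_succs prefix_rel w" "v \<in> tree_succs prefix_rel w" "u \<noteq> v" "w \<in> binary_words"
  shows "branch u ` axis_point ` {0<..<1} \<inter> branch v ` axis_point ` {0<..<1} = {}"
proof -
  have "branch (w @ [0]) (axis_point x) \<noteq> branch (w @ [1]) (axis_point y)"
    if "x \<in> {0<..<1}" "y \<in> {0<..<1}" for x y
  proof -
    have "ratio (w @ [0]) * x < ratio (w @ [0]) * 1" "0 < ratio (w @ [1]) * y"
      using that ratio_pos by (auto intro: mult_strict_left_mono mult_pos_pos)
    then have "ratio (w @ [0]) * x < 1 / 2" "1 / 2 < ratio (w @ [1]) * y + (1 - ratio (w @ [1]))"
      using ratio_le[of "w @ [0]"] ratio_le[of "w @ [1]"] by linarith+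
    then show ?thesis by (simp add: branch_axis_point)
  qed
  then have disjoint: "branch (w @ [0]) ` axis_point ` {0<..<1}
      \<inter> branch (w @ [1]) ` axis_point ` {0<..<1} = {}"
    by blast
  have "(u = w @ [0] \<and> v = w @ [1]) \<or> (u = w @ [1] \<and> v = w @ [0])"
    using assms unfolding tree_succs_prefix_rel[OF assms(4)] by blast
  then show ?thesis
    using disjoint by (metis Int_commute)
qed

text \<open>
At an endpoint of the interval, the cone of angle \<open>\<pi> / 2\<close> that points inwards is an open
half-interval.
\<close>

lemma cone_condition_unit_interval:
  assumes "x \<in> axis_point ` {0, 1}"
  shows "\<exists>v\<in>range axis_point. norm v = 1 \<and> open_cone (range axis_point) x (pi / 2) 1 v \<subseteq> axis_point ` {0<..<1}"
proof -
  have "open_cone (range axis_point) (axis_point 0) (pi / 2) 1 (axis_point 1) \<subseteq> axis_point ` {0<..<1}"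
    by (auto simp: open_cone_def)
  moreover have "open_cone (range axis_point) (axis_point 1) (pi / 2) 1 (axis_point (- 1)) \<subseteq> axis_point ` {0<..<1}"
    by (auto simp: open_cone_def simp flip: axis_point_diff)
  ultimately show ?thesis
    using assms by force
qed

text \<open>
All the maps are similarities of the whole line, so \<open>V\<close> can be the line itself and the
distortion constant is \<open>1\<close>.
\<close>

lemma conformal_TIFS_branch: "conformal_TIFS 1 (axis_point ` {0..1}) binary_words prefix_rel branch"
proof -
  let ?E = "range axis_point" and ?X = "axis_point ` {0..1}"
  have int: "top_of_set ?E interior_of ?X = axis_point ` {0<..<1}"
    by (simp add: interior_of_axis_point interior_atLeastAtMost_real)
  have front: "top_of_set ?E frontier_of ?X = axis_point ` {0, 1}"
    by (simp add: frontier_of_axis_point frontier_def interior_atLeastAtMost_real)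
  have axis_point_in: "axis_point x \<in> ?E" for x
    by simp
  have maps: "branch w ` ?E \<subseteq> ?E \<and> C1_diffeo_onto_image ?E ?E (branch w) \<and> conformal_on ?E ?E (branch w)"
    for w
  proof -
    have "ratio w \<noteq> 0" using ratio_pos[of w] by simp
    then show ?thesis
      unfolding branch_def
      by (intro conjI equalityD1 similarity_image_subspace C1_diffeo_similarity
          conformal_on_similarity subspace_range_axis_point axis_point_in)
  qed
  have "deriv_norm ?E (tifs_comp prefix_rel branch w) x = contraction w"
    if "w \<in> binary_words" "x \<in> ?E" for w x
    unfolding tifs_comp_branch[OF that(1)]
  proof (rule deriv_norm_similarity[OF subspace_range_axis_point that(2) axis_point_in])
    show "axis_point 1 \<noteq> 0" using axis_point_eq_iff[of 1 0] by (simp del: axis_point_eq_iff)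
  qed (use contraction_pos[of w] in simp)
  then have distortion: "\<exists>K\<ge>1. \<forall>w\<in>binary_words. \<forall>x\<in>?E. \<forall>y\<in>?E.
      deriv_norm ?E (tifs_comp prefix_rel branch w) x \<le> K * deriv_norm ?E (tifs_comp prefix_rel branch w) y"
    by (intro exI[of _ 1]) auto
  show ?thesis
    unfolding conformal_TIFS_def euclid_1_eq
  proof (intro conjI)
    show "\<exists>V. openin (top_of_set ?E) V \<and> ?X \<subseteq> V \<and>
      (\<forall>\<tau>\<in>binary_words - {tree_root binary_words prefix_rel}. branch \<tau> ` V \<subseteq> V \<and>
        C1_diffeo_onto_image ?E V (branch \<tau>) \<and> conformal_on ?E V (branch \<tau>)) \<and>
      (\<exists>K\<ge>1. \<forall>\<tau>\<in>binary_words. \<forall>x\<in>V. \<forall>y\<in>V.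
        deriv_norm ?E (tifs_comp prefix_rel branch \<tau>) x
          \<le> K * deriv_norm ?E (tifs_comp prefix_rel branch \<tau>) y)"
      using maps distortion by (intro exI[of _ ?E]) (auto simp: axis_point_in)
    show "\<exists>\<alpha> l. 0 < \<alpha> \<and> \<alpha> < pi \<and> 0 < l \<and>
      (\<forall>x\<in>top_of_set ?E frontier_of ?X. \<exists>v\<in>?E. norm v = 1 \<and>
        open_cone ?E x \<alpha> l v \<subseteq> top_of_set ?E interior_of ?X)"
      unfolding int front using cone_condition_unit_interval
      by (intro exI[of _ "pi / 2"] exI[of _ 1]) auto
    show "\<forall>\<tau>\<in>binary_words. \<forall>\<omega>\<in>tree_succs prefix_rel \<tau>. \<forall>\<rho>\<in>tree_succs prefix_rel \<tau>. \<omega> \<noteq> \<rho> \<longrightarrow>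
      branch \<omega> ` (top_of_set ?E interior_of ?X) \<inter> branch \<rho> ` (top_of_set ?E interior_of ?X) = {}"
      unfolding int using open_set_condition_branch by blast
  qed (simp_all add: TIFS_branch)
qed

section \<open>Critical exponents\<close>

lemma Inf_ereal_threshold:
  fixes s :: real
  assumes "\<And>t. s < t \<Longrightarrow> t \<in> S" "\<And>t. t \<in> S \<Longrightarrow> s \<le> t"
  shows "Inf (ereal ` S) = ereal s"
proof (rule antisym)
  show "Inf (ereal ` S) \<le> ereal s"
  proof (rule ereal_le_epsilon2)
    fix e :: real assume "0 < e"
    then show "Inf (ereal ` S) \<le> ereal s + ereal e"
      using assms(1)[of "s + e"] by (auto intro!: Inf_lower)
  qed
  show "ereal s \<le> Inf (ereal ` S)"
    using assms(2) by (auto intro!: Inf_greatest)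
qed

lemma powr_3_le_2:
  assumes "t \<le> ln 2 / ln 3"
  shows "3 powr t \<le> (2::real)"
proof -
  have "t * ln 3 \<le> ln 2" using assms by (simp add: field_simps)
  then have "exp (t * ln 3) \<le> exp (ln 2)" by (subst exp_le_cancel_iff)
  then show ?thesis by (simp add: powr_def)
qed

lemma half_power_le_third_power_powr:
  assumes "t \<le> ln 2 / ln 3"
  shows "(1 / 2 :: real) ^ n \<le> ((1 / 3) ^ n) powr t"
proof -
  have "(1 / 2 :: real) ^ n \<le> (1 / 3 powr t) ^ n"
    using powr_3_le_2[OF assms] by (intro power_mono divide_left_mono) auto
  also have "\<dots> = ((1 / 3) ^ n) powr t"
    by (simp add: powr_divide powr_powr mult.commute power_divide flip: powr_realpow)
  finally show ?thesis .
qed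

section \<open>The antichain exponent\<close>

lemma finite_tree_upto: "finite (tree_upto binary_words prefix_rel n)"
proof (rule finite_subset)
  show "tree_upto binary_words prefix_rel n \<subseteq> (\<Union>k\<le>n. {w \<in> binary_words. length w = k})"
    by (auto simp: tree_upto_def)
qed (simp add: finite_binary_words_length)

definition maximal_antichains :: "nat \<Rightarrow> nat list set set"
  where "maximal_antichains n =
    {A. maximal_antichain (tree_upto binary_words prefix_rel n - {[]}) prefix_rel A}"

lemma finite_maximal_antichains: "finite (maximal_antichains n)"
proof (rule finite_subset)
  show "maximal_antichains n \<subseteq> Pow (tree_upto binary_words prefix_rel n)"
    unfolding maximal_antichains_def maximal_antichain_def by blast
qed (simp add: finite_tree_upto)

lemma spine_cut_maximal_antichains:
  "1 \<le> M \<Longrightarrow> M \<le> L \<Longrightarrow> L \<le> n \<Longrightarrow> spine_cut M L \<in> maximal_antichains n"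
  by (simp add: maximal_antichains_def maximal_antichain_spine_cut)

lemma maximal_antichains_nonempty: "1 \<le> n \<Longrightarrow> maximal_antichains n \<noteq> {}"
  using spine_cut_maximal_antichains[of 1 1 n] by auto

definition min_antichain_sum :: "real \<Rightarrow> nat \<Rightarrow> real"
  where "min_antichain_sum t n =
    Min ((\<lambda>A. \<Sum>w\<in>A. contraction w powr t) ` maximal_antichains n)"

lemma antichain_pressure_branch:
  "antichain_pressure 1 (axis_point ` {0..1}) binary_words prefix_rel branch n t = min_antichain_sum t n"
proof -
  have "(\<Sum>w\<in>A. sup_deriv_norm (euclid 1) (axis_point ` {0..1}) (tifs_comp prefix_rel branch w) powr t)
      = (\<Sum>w\<in>A. contraction w powr t)" if "A \<in> maximal_antichains n" for A
  proof (rule sum.cong[OF refl])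
    fix w assume "w \<in> A"
    then have "w \<in> binary_words"
      using that maximal_antichainD(1) unfolding maximal_antichains_def by blast
    then show "sup_deriv_norm (euclid 1) (axis_point ` {0..1}) (tifs_comp prefix_rel branch w) powr t
        = contraction w powr t"
      by (simp only: euclid_1_eq sup_deriv_norm_tifs_comp)
  qed
  then have "(\<lambda>A. \<Sum>w\<in>A. sup_deriv_norm (euclid 1) (axis_point ` {0..1})
        (tifs_comp prefix_rel branch w) powr t) ` maximal_antichains n
      = (\<lambda>A. \<Sum>w\<in>A. contraction w powr t) ` maximal_antichains n"
    by (intro image_cong) auto
  then show ?thesis
    by (simp only: antichain_pressure_def min_antichain_sum_def tree_root_prefix_rel maximal_antichains_def image_Collect)
qed

lemma min_antichain_sum_Suc_le: "1 \<le> n \<Longrightarrow> min_antichain_sum t (Suc n) \<le> min_antichain_sum t n"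
  unfolding min_antichain_sum_def
proof (rule Min_antimono)
  assume n: "1 \<le> n"
  show "(\<lambda>A. \<Sum>w\<in>A. contraction w powr t) ` maximal_antichains n
      \<subseteq> (\<lambda>A. \<Sum>w\<in>A. contraction w powr t) ` maximal_antichains (Suc n)"
    unfolding maximal_antichains_def using maximal_antichain_mono[OF n] by blast
qed (auto simp: finite_maximal_antichains maximal_antichains_nonempty)

lemma min_antichain_sum_nonneg: "1 \<le> n \<Longrightarrow> 0 \<le> min_antichain_sum t n"
  unfolding min_antichain_sum_def
  by (subst Min_ge_iff) (auto simp: finite_maximal_antichains maximal_antichains_nonempty sum_nonneg)

text \<open>
Every ratio is at least \<open>1 / 3\<close>, and \<open>3\<^sup>-\<^sup>t \<ge> 1 / 2\<close> for these exponents, so Kraft's inequality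
applies to all antichains at once.
\<close>

lemma min_antichain_sum_ge_1:
  assumes "1 \<le> n" "0 \<le> t" "t \<le> ln 2 / ln 3"
  shows "1 \<le> min_antichain_sum t n"
proof -
  have "1 \<le> (\<Sum>w\<in>A. contraction w powr t)" if "A \<in> maximal_antichains n" for A
  proof -
    have "1 \<le> (\<Sum>w\<in>A. (1 / 2 :: real) ^ length w)"
      using sum_half_power_maximal_antichain[of n A] assms that by (simp add: maximal_antichains_def)
    also have "\<dots> \<le> (\<Sum>w\<in>A. contraction w powr t)"
    proof (rule sum_mono)
      fix w :: "nat list"
      have "(1 / 2 :: real) ^ length w \<le> ((1 / 3) ^ length w) powr t"
        using assms by (intro half_power_le_third_power_powr)
      also have "\<dots> \<le> contraction w powr t"
        using contraction_ge[of w] assms by (intro powr_mono2) auto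
      finally show "(1 / 2 :: real) ^ length w \<le> contraction w powr t" .
    qed
    finally show ?thesis .
  qed
  then show ?thesis
    unfolding min_antichain_sum_def using assms
    by (subst Min_ge_iff) (auto simp: finite_maximal_antichains maximal_antichains_nonempty)
qed

lemma min_antichain_sum_tendsto_0:
  assumes "ln 2 / ln 3 < t"
  shows "min_antichain_sum t \<longlonglongrightarrow> 0"
proof (rule LIMSEQ_I)
  fix \<epsilon> :: real assume "0 < \<epsilon>"
  from exists_spine_cut_sum_less[OF assms this zero_less_one]
  obtain M L where le: "1 \<le> M" "M \<le> L" and sum: "(\<Sum>w\<in>spine_cut M L. contraction w powr t) < \<epsilon>"
    by blast
  have "norm (min_antichain_sum t n - 0) < \<epsilon>" if "n \<ge> L" for n
  proof -
    have "min_antichain_sum t n \<le> (\<Sum>w\<in>spine_cut M L. contraction w powr t)"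
      unfolding min_antichain_sum_def using le that
      by (intro Min_le imageI spine_cut_maximal_antichains) (simp_all add: finite_maximal_antichains)
    then show ?thesis using sum min_antichain_sum_nonneg[of n] le that by simp
  qed
  then show "\<exists>N. \<forall>n\<ge>N. norm (min_antichain_sum t n - 0) < \<epsilon>" by blast
qed

text \<open>
The constant \<open>lim\<close> says something only about convergent sequences, so monotonicity is needed in
addition to the bound. The index is shifted because the empty antichain makes the value at \<open>n = 0\<close>
vanish.
\<close>

lemma min_antichain_sum_lim_ge_1:
  assumes "0 \<le> t" "t \<le> ln 2 / ln 3"
  shows "1 \<le> lim (min_antichain_sum t)"
proof -
  have "decseq (\<lambda>n. min_antichain_sum t (Suc n))"
    using min_antichain_sum_Suc_le by (intro decseq_SucI) simp
  then obtain l where "(\<lambda>n. min_antichain_sum t (Suc n)) \<longlonglongrightarrow> l"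
    using min_antichain_sum_ge_1[OF _ assms] by (auto elim: decseq_convergent[of _ 1])
  then have l: "min_antichain_sum t \<longlonglongrightarrow> l" by (rule LIMSEQ_imp_Suc)
  then have "1 \<le> l"
    using min_antichain_sum_ge_1[OF _ assms] by (intro LIMSEQ_le_const) auto
  with l show ?thesis by (simp add: limI)
qed

lemma ln_2_div_ln_3_nonneg: "0 \<le> ln 2 / ln (3::real)"
  by simp

lemma beta_star_branch:
  "beta_star 1 (axis_point ` {0..1}) binary_words prefix_rel branch = ereal (ln 2 / ln 3)"
  unfolding beta_star_def antichain_pressure_branch
proof (rule Inf_ereal_threshold)
  fix t :: real assume "ln 2 / ln 3 < t"
  moreover from this have "0 \<le> t"
    using ln_2_div_ln_3_nonneg by linarith
  ultimately show "t \<in> {t. 0 \<le> t \<and> lim (min_antichain_sum t) = 0}"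
    using limI[OF min_antichain_sum_tendsto_0] by auto
next
  fix t :: real
  assume "t \<in> {t. 0 \<le> t \<and> lim (min_antichain_sum t) = 0}"
  then show "ln 2 / ln 3 \<le> t"
    using min_antichain_sum_lim_ge_1[of t] by fastforce
qed

section \<open>The level exponent\<close>

definition level_sum :: "real \<Rightarrow> nat \<Rightarrow> real"
  where "level_sum t n = (\<Sum>w | w \<in> binary_words \<and> length w = n. contraction w powr t)"

lemma level_pressure_branch:
  "level_pressure 1 (axis_point ` {0..1}) binary_words prefix_rel branch n t = level_sum t n"
proof -
  have "tree_level binary_words prefix_rel n = {w \<in> binary_words. length w = n}"
    by (auto simp: tree_level_def)
  then show ?thesis
    unfolding level_pressure_def level_sum_def euclid_1_eq by (auto intro!: sum.cong simp: sup_deriv_norm_tifs_comp)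
qed

text \<open>
Only the words with at least \<open>k\<close> leading zeros are counted. They are still dyadic at level \<open>n\<close>, and
there are \<open>2\<^sup>n\<^sup>-\<^sup>k\<close> of them.
\<close>

lemma level_sum_ge:
  assumes "k \<le> n" "n \<le> (k + 1)\<^sup>2"
  shows "2 powr (real n * (1 - t) - real k) \<le> level_sum t n"
proof -
  let ?B = "{w \<in> binary_words. length w = n \<and> prefix (replicate k 0) w}"
  have "contraction w = (1 / 2) ^ n" if "w \<in> ?B" for w
  proof -
    have "(k + 1)\<^sup>2 \<le> (leading_zeros w + 1)\<^sup>2"
      using that by (intro power_mono) (auto simp: prefix_replicate_iff_leading_zeros)
    with assms that have "length w \<le> (leading_zeros w + 1)\<^sup>2"
      by (metis (mono_tags, lifting) le_trans mem_Collect_eq)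
    then show ?thesis using that contraction_eq_half_power by simp
  qed
  then have "(\<Sum>w\<in>?B. contraction w powr t) = real (card ?B) * ((1 / 2) ^ n) powr t"
    by simp
  also have "card ?B = 2 ^ (n - k)"
    using card_binary_words_extending[of "replicate k 0" n] assms by simp
  also have "real (2 ^ (n - k)) * ((1 / 2) ^ n) powr t = 2 powr (real n * (1 - t) - real k)"
  proof -
    have "real (2 ^ (n - k)) = 2 powr (real n - real k)"
      using assms by (simp add: of_nat_diff flip: powr_realpow)
    moreover have "((1 / 2 :: real) ^ n) powr t = 2 powr (- (real n * t))"
      by (simp add: powr_powr powr_minus_divide powr_divide flip: powr_realpow)
    ultimately show ?thesis
      by (simp add: algebra_simps flip: powr_add)
  qed
  finally have "2 powr (real n * (1 - t) - real k) = (\<Sum>w\<in>?B. contraction w powr t)" by simp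
  also have "\<dots> \<le> level_sum t n"
    unfolding level_sum_def by (intro sum_mono2 finite_binary_words_length) auto
  finally show ?thesis .
qed

text \<open>
With \<open>k\<close> about \<open>\<surd>n\<close> the loss \<open>2\<^sup>-\<^sup>k\<close> from restricting to these words is dominated by
the gain \<open>2\<^bsup>n (1 - t)\<^esup>\<close>.
\<close>

lemma level_sum_ge_1:
  assumes "t < 1"
  shows "\<forall>\<^sub>F n in sequentially. 1 \<le> level_sum t n"
proof -
  have "filterlim (\<lambda>n. sqrt (real n)) at_top sequentially"
    by (intro filterlim_compose[OF sqrt_at_top] filterlim_real_sequentially)
  then have "\<forall>\<^sub>F n in sequentially. 1 / (1 - t) \<le> sqrt (real n)"
    by (simp add: filterlim_at_top)
  then show ?thesis
    using eventually_ge_at_top[of 1]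
  proof eventually_elim
    case (elim n)
    \<comment> \<open>the least number of leading zeros for which the words are still dyadic at level \<open>n\<close>, up to rounding\<close>
    define k where "k = nat \<lfloor>sqrt (real n)\<rfloor>"
    have k: "real k \<le> sqrt (real n)" "sqrt (real n) < real k + 1"
      by (simp_all add: k_def)
    have "sqrt (real n) * 1 \<le> sqrt (real n) * sqrt (real n)"
      using elim by (intro mult_left_mono) auto
    with k have "k \<le> n" by simp
    have "real n = (sqrt (real n))\<^sup>2" by simp
    also have "\<dots> \<le> (real k + 1)\<^sup>2" using k by (intro power_mono) auto
    finally have "real n \<le> real ((k + 1)\<^sup>2)" by (simp add: add.commute)
    then have "n \<le> (k + 1)\<^sup>2" by (simp only: of_nat_le_iff)
    have "sqrt (real n) * 1 \<le> sqrt (real n) * (sqrt (real n) * (1 - t))"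
      using elim assms by (intro mult_left_mono) (auto simp: field_simps)
    also have "\<dots> = real n * (1 - t)" by simp
    finally have "0 \<le> real n * (1 - t) - real k" using k by simp
    then have "1 \<le> 2 powr (real n * (1 - t) - real k)" by (simp add: ge_one_powr_ge_zero)
    also have "\<dots> \<le> level_sum t n"
      using \<open>k \<le> n\<close> \<open>n \<le> (k + 1)\<^sup>2\<close> by (rule level_sum_ge)
    finally show ?case .
  qed
qed

text \<open>
There are \<open>2\<^sup>n\<close> words of length \<open>n\<close>, and each of them contracts by a factor of at most \<open>2\<^sup>-\<^sup>n\<close>.
\<close>

lemma level_sum_tendsto_0:
  assumes "1 < t"
  shows "level_sum t \<longlonglongrightarrow> 0"
proof (rule tendsto_sandwich)
  show "\<forall>\<^sub>F n in sequentially. 0 \<le> level_sum t n"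
    by (simp add: level_sum_def sum_nonneg)
  have "level_sum t n \<le> (2 * (1 / 2) powr t) ^ n" for n
  proof -
    have "level_sum t n \<le> (\<Sum>w | w \<in> binary_words \<and> length w = n. ((1 / 2) ^ n) powr t)"
      unfolding level_sum_def
    proof (rule sum_mono)
      fix w assume "w \<in> {w \<in> binary_words. length w = n}"
      then show "contraction w powr t \<le> ((1 / 2) ^ n) powr t"
        using contraction_le[of w] contraction_pos[of w] assms by (intro powr_mono2) auto
    qed
    also have "\<dots> = 2 ^ n * ((1 / 2) ^ n) powr t"
      by (simp add: card_binary_words_length)
    also have "((1 / 2 :: real) ^ n) powr t = ((1 / 2) powr t) ^ n"
      by (simp add: powr_powr mult.commute flip: powr_realpow)
    finally show ?thesis by (simp add: power_mult_distrib)
  qed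
  then show "\<forall>\<^sub>F n in sequentially. level_sum t n \<le> (2 * (1 / 2) powr t) ^ n" by simp
  have "(1 / 2) powr t < (1 / 2 :: real) powr 1"
    using assms by (intro powr_less_mono') auto
  then show "(\<lambda>n. (2 * (1 / 2) powr t) ^ n) \<longlonglongrightarrow> (0::real)"
    by (intro LIMSEQ_power_zero) simp
qed simp

lemma beta_branch: "beta 1 (axis_point ` {0..1}) binary_words prefix_rel branch = 1"
proof -
  have "Inf (ereal ` {t. 0 \<le> t \<and> liminf (\<lambda>n. ereal (level_sum t n)) = 0}) = ereal 1"
  proof (rule Inf_ereal_threshold)
    fix t :: real assume "1 < t"
    then have "(\<lambda>n. ereal (level_sum t n)) \<longlonglongrightarrow> ereal 0"
      by (intro tendsto_ereal level_sum_tendsto_0)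
    then have "liminf (\<lambda>n. ereal (level_sum t n)) = ereal 0"
      by (rule lim_imp_Liminf[OF trivial_limit_sequentially])
    with \<open>1 < t\<close> show "t \<in> {t. 0 \<le> t \<and> liminf (\<lambda>n. ereal (level_sum t n)) = 0}"
      by (simp add: zero_ereal_def)
  next
    fix t :: real assume "t \<in> {t. 0 \<le> t \<and> liminf (\<lambda>n. ereal (level_sum t n)) = 0}"
    then have liminf: "liminf (\<lambda>n. ereal (level_sum t n)) = 0" by simp
    show "1 \<le> t"
    proof (rule ccontr)
      assume "\<not> 1 \<le> t"
      then have "\<forall>\<^sub>F n in sequentially. ereal 1 \<le> ereal (level_sum t n)"
        unfolding ereal_less_eq by (intro level_sum_ge_1) simp
      then have "ereal 1 \<le> liminf (\<lambda>n. ereal (level_sum t n))"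
        by (rule Liminf_bounded)
      with liminf show False by simp
    qed
  qed
  then show ?thesis
    by (simp only: beta_def level_pressure_branch one_ereal_def)
qed

section \<open>Two estimates for Hausdorff measures\<close>

text \<open>
The cover is padded with empty sets, whose gauge is \<open>0\<close> for every exponent.
\<close>

lemma hausdorff_premeasure_le_finite_cover:
  assumes "finite I" "A \<subseteq> (\<Union>i\<in>I. C i)" "0 \<le> \<delta>"
    and C: "\<And>i. i \<in> I \<Longrightarrow> bounded (C i) \<and> diameter (C i) \<le> \<delta>"
  shows "hausdorff_premeasure s \<delta> A \<le> (\<Sum>i\<in>I. hausdorff_gauge s (C i))"
proof -
  obtain f where f: "bij_betw f {0..<card I} I"
    using ex_bij_betw_nat_finite[OF assms(1)] by blast
  define U where "U k = (if k < card I then C (f k) else {})" for k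
  have fI: "f k \<in> I" if "k < card I" for k
    using f that by (auto simp: bij_betw_def)
  have "(\<Union>i\<in>I. C i) \<subseteq> (\<Union>k. U k)"
  proof
    fix x assume "x \<in> (\<Union>i\<in>I. C i)"
    then obtain k where "k < card I" "x \<in> C (f k)"
      using f unfolding bij_betw_def by force
    then have "x \<in> U k" by (simp add: U_def)
    then show "x \<in> (\<Union>k. U k)" by blast
  qed
  moreover have "bounded (U k) \<and> diameter (U k) \<le> \<delta>" for k
    using C[OF fI] \<open>0 \<le> \<delta>\<close> by (simp add: U_def)
  ultimately have "hausdorff_premeasure s \<delta> A \<le> suminf (\<lambda>k. hausdorff_gauge s (U k))"
    unfolding hausdorff_premeasure_def using assms(2) by (intro INF_lower) auto
  also have "\<dots> = (\<Sum>k\<in>{0..<card I}. hausdorff_gauge s (U k))"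
    by (intro suminf_finite) (auto simp: U_def hausdorff_gauge_def)
  also have "\<dots> = (\<Sum>k\<in>{0..<card I}. hausdorff_gauge s (C (f k)))"
    by (intro sum.cong) (auto simp: U_def)
  also have "\<dots> = (\<Sum>i\<in>I. hausdorff_gauge s (C i))"
    by (rule sum.reindex_bij_betw[OF f])
  finally show ?thesis .
qed

text \<open>
The hypothesis \<open>Hoelder\<close> says that the inverse of \<open>P\<close> is Hoelder continuous with exponent \<open>t\<close>. Pulled back
along \<open>P\<close>, a cover of \<open>A\<close> therefore becomes a cover of \<open>[0, 1)\<close> by sets that are contained in
intervals of length at most \<open>2 C\<close> times the gauge, and the lengths of these intervals add up to at
least \<open>1\<close>.
\<close>

lemma hausdorff_measure_nonzero:
  fixes P :: "real \<Rightarrow> 'a::metric_space"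
  assumes P: "P ` {0..<1} \<subseteq> A" and t: "0 \<le> t" and C: "0 < C"
    and Hoelder: "\<And>x y. x \<in> {0..<1} \<Longrightarrow> y \<in> {0..<1} \<Longrightarrow> x \<noteq> y
      \<Longrightarrow> \<bar>x - y\<bar> \<le> C * dist (P x) (P y) powr t"
  shows "hausdorff_measure t A \<noteq> 0"
proof -
  have "ennreal (1 / (2 * C)) \<le> hausdorff_premeasure t 1 A"
    unfolding hausdorff_premeasure_def
  proof (rule INF_greatest)
    fix U :: "nat \<Rightarrow> 'a set"
    assume "U \<in> {U. A \<subseteq> (\<Union>i. U i) \<and> (\<forall>i. bounded (U i) \<and> diameter (U i) \<le> 1)}"
    then have U: "A \<subseteq> (\<Union>i. U i)" "\<And>i. bounded (U i)" by auto
    have "\<exists>a b. {x \<in> {0..<1}. P x \<in> U i} \<subseteq> {a..b}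
        \<and> emeasure lborel {a..b} \<le> ennreal (2 * C) * hausdorff_gauge t (U i)" for i
    proof (cases "{x \<in> {0..<1}. P x \<in> U i} = {}")
      case True
      \<comment> \<open>the empty interval\<close>
      then show ?thesis by (intro exI[of _ 1] exI[of _ 0]) auto
    next
      case False
      then obtain z where z: "z \<in> {0..<1}" "P z \<in> U i" by blast
      \<comment> \<open>For \<open>t = 0\<close> the gauge of a nonempty set is \<open>1\<close>, whereas \<open>0 powr 0 = 0\<close>.\<close>
      define D where "D = (if t = 0 then 1 else diameter (U i) powr t)"
      have gauge: "hausdorff_gauge t (U i) = ennreal D" and D: "0 \<le> D"
        using z by (auto simp: hausdorff_gauge_def D_def)
      have "\<bar>x - z\<bar> \<le> C * D" if x: "x \<in> {0..<1}" "P x \<in> U i" for x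
      proof (cases "x = z")
        case True
        then show ?thesis using C D by simp
      next
        case False
        have "dist (P x) (P z) powr t \<le> D"
          using diameter_bounded_bound[OF U(2) x(2) z(2)] t
          by (auto simp: D_def powr_def[of _ 0] intro: powr_mono2)
        then have "C * dist (P x) (P z) powr t \<le> C * D"
          using C by simp
        with Hoelder[OF x(1) z(1) False] show ?thesis by linarith
      qed
      then have "{x \<in> {0..<1}. P x \<in> U i} \<subseteq> {z - C * D .. z + C * D}"
        by (fastforce simp: abs_le_iff)
      moreover have "emeasure lborel {z - C * D .. z + C * D} = ennreal (2 * C) * hausdorff_gauge t (U i)"
        using C D by (simp add: gauge ennreal_mult'[symmetric] mult.assoc)
      ultimately show ?thesis by (intro exI[of _ "z - C * D"] exI[of _ "z + C * D"]) auto
    qed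
    then obtain a b where ab: "\<And>i. {x \<in> {0..<1}. P x \<in> U i} \<subseteq> {a i..b i}"
        "\<And>i. emeasure lborel {a i..b i} \<le> ennreal (2 * C) * hausdorff_gauge t (U i)"
      by metis
    have "{0..<1} \<subseteq> (\<Union>i. {a i..b i})"
    proof
      fix x :: real assume x: "x \<in> {0..<1}"
      then obtain i where "P x \<in> U i" using P U(1) by blast
      with x ab(1)[of i] show "x \<in> (\<Union>i. {a i..b i})" by blast
    qed
    then have "emeasure lborel {0..<1::real} \<le> emeasure lborel (\<Union>i. {a i..b i})"
      by (intro emeasure_mono) auto
    also have "\<dots> \<le> suminf (\<lambda>i. emeasure lborel {a i..b i})"
      by (intro emeasure_subadditive_countably) auto
    also have "\<dots> \<le> suminf (\<lambda>i. ennreal (2 * C) * hausdorff_gauge t (U i))"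
      by (intro suminf_le ab summableI)
    also have "\<dots> = ennreal (2 * C) * suminf (\<lambda>i. hausdorff_gauge t (U i))"
      by simp
    finally have "ennreal (1 / (2 * C)) * 1
        \<le> ennreal (1 / (2 * C)) * (ennreal (2 * C) * suminf (\<lambda>i. hausdorff_gauge t (U i)))"
      by (intro mult_left_mono) auto
    moreover have "ennreal (1 / (2 * C)) * ennreal (2 * C) = 1"
      using C by (subst ennreal_mult[symmetric]) auto
    ultimately show "ennreal (1 / (2 * C)) \<le> suminf (\<lambda>i. hausdorff_gauge t (U i))"
      by (simp only: mult.assoc[symmetric] mult_1 mult_1_right)
  qed
  also have "\<dots> \<le> hausdorff_measure t A"
    unfolding hausdorff_measure_def by (intro SUP_upper) auto
  finally show ?thesis
    using C by (auto simp: ennreal_eq_0_iff)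
qed

section \<open>The limit set\<close>

lemma cylinder_snoc_subset:
  assumes "i \<in> {0, 1}"
  shows "cylinder (w @ [i]) \<subseteq> cylinder w"
proof -
  have "0 \<le> contraction w * (1 - ratio (w @ [i]))" "0 \<le> contraction w * ratio (w @ [i])"
    using contraction_pos[of w] ratio_le[of "w @ [i]"] ratio_pos[of "w @ [i]"] by simp_all
  then show ?thesis
    using assms by (auto simp: cylinder_def algebra_simps)
qed

text \<open>
The definition of the coding map yields information only after the nested cylinders are known to
have exactly one common point.
\<close>

lemma coding_map_in_cylinder:
  assumes \<omega>: "\<omega> \<in> tree_boundary binary_words prefix_rel"
  shows "coding_map (axis_point ` {0..1}) prefix_rel branch \<omega> \<in> axis_point ` cylinder (\<omega> n)"
proof -
  note tree_boundary_binary_words[OF \<omega>, simp]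
  have sub: "cylinder (\<omega> (Suc n)) \<subseteq> cylinder (\<omega> n)" for n
  proof -
    have "\<omega> (Suc n) \<in> tree_succs prefix_rel (\<omega> n)"
      using \<omega> by (simp add: tree_boundary_def)
    then obtain i where "i \<in> {0, 1}" "\<omega> (Suc n) = \<omega> n @ [i]"
      by (auto simp: tree_succs_prefix_rel)
    then show ?thesis using cylinder_snoc_subset by metis
  qed
  let ?f = "\<lambda>n. left_end (\<omega> n)" and ?g = "\<lambda>n. left_end (\<omega> n) + contraction (\<omega> n)"
  have "?f n \<in> cylinder (\<omega> n)" "?g n \<in> cylinder (\<omega> n)" for n
    using contraction_pos[of "\<omega> n"] by (simp_all add: cylinder_def)
  then have mono: "?f n \<le> ?f (Suc n)" "?g (Suc n) \<le> ?g n" for n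
    using sub[of n] by (auto simp: cylinder_def subset_iff)
  have small: "(\<lambda>n. contraction (\<omega> n)) \<longlonglongrightarrow> 0"
  proof (rule tendsto_sandwich)
    show "\<forall>\<^sub>F n in sequentially. 0 \<le> contraction (\<omega> n)"
      using contraction_pos by (simp add: less_imp_le)
    have "contraction (\<omega> n) \<le> (1 / 2) ^ n" for n
      using contraction_le[of "\<omega> n"] by simp
    then show "\<forall>\<^sub>F n in sequentially. contraction (\<omega> n) \<le> (1 / 2) ^ n" by simp
    show "(\<lambda>n. (1 / 2) ^ n) \<longlonglongrightarrow> (0::real)"
      by (intro LIMSEQ_power_zero) simp
  qed simp
  have "?f n - ?g n = - contraction (\<omega> n)" for n by simp
  then have "(\<lambda>n. ?f n - ?g n) \<longlonglongrightarrow> 0"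
    using tendsto_minus[OF small] by simp
  then obtain l where l: "\<And>n. ?f n \<le> l" "\<And>n. l \<le> ?g n"
    using nested_sequence_unique[of ?f ?g] mono contraction_pos by (auto simp: less_imp_le)
  have "(\<Inter>n\<in>{1..}. cylinder (\<omega> n)) = {l}"
  proof (intro set_eqI iffI)
    fix y assume y: "y \<in> (\<Inter>n\<in>{1..}. cylinder (\<omega> n))"
    have "\<forall>\<^sub>F n in sequentially. \<bar>y - l\<bar> \<le> contraction (\<omega> n)"
      using eventually_ge_at_top[of 1]
    proof eventually_elim
      case (elim n)
      then have "y \<in> cylinder (\<omega> n)" using y by auto
      then show ?case using l[of n] by (auto simp: cylinder_def)
    qed
    then have "\<bar>y - l\<bar> \<le> 0"
      using small by (intro tendsto_lowerbound[OF small]) auto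
    then show "y \<in> {l}" by simp
  qed (use l in \<open>auto simp: cylinder_def\<close>)
  moreover have "(\<Inter>n\<in>{1..}. axis_point ` cylinder (\<omega> n)) = axis_point ` (\<Inter>n\<in>{1..}. cylinder (\<omega> n))"
    by (rule image_INT[symmetric, where C = UNIV and j = 1]) (auto simp: inj_on_def)
  ultimately have "(\<Inter>n\<in>{1..}. tifs_comp prefix_rel branch (\<omega> n) ` (axis_point ` {0..1})) = {axis_point l}"
    by (simp add: tifs_comp_image)
  then have "coding_map (axis_point ` {0..1}) prefix_rel branch \<omega> = axis_point l"
    by (simp add: coding_map_def)
  then show ?thesis
    using l[of n] by (auto simp: cylinder_def)
qed

text \<open>
Every infinite path passes through the cut.
\<close>

lemma limit_set_subset_spine_cut:
  "limit_set (axis_point ` {0..1}) binary_words prefix_rel branch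
    \<subseteq> (\<Union>w\<in>spine_cut M L. axis_point ` cylinder w)"
  unfolding limit_set_def
proof (rule image_subsetI)
  fix \<omega> assume \<omega>: "\<omega> \<in> tree_boundary binary_words prefix_rel"
  note b = tree_boundary_binary_words[OF \<omega>]
  obtain a where a: "a \<in> spine_cut M L" "prefix a (\<omega> L)"
    using spine_cut_hits_words[OF b(1,2)] by blast
  then have "length a \<le> L" using b(2)[of L] by (metis prefix_length_le)
  have "a = take (length a) (\<omega> L)" using a(2) by (auto simp: prefix_def)
  also have "\<dots> = \<omega> (length a)" using b(3) \<open>length a \<le> L\<close> by blast
  finally show "coding_map (axis_point ` {0..1}) prefix_rel branch \<omega>
      \<in> (\<Union>w\<in>spine_cut M L. axis_point ` cylinder w)"
    using a(1) coding_map_in_cylinder[OF \<omega>, of "length a"] by auto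
qed

lemma diameter_cylinder_le:
  "bounded (axis_point ` cylinder w)" "diameter (axis_point ` cylinder w) \<le> contraction w"
proof -
  have "dist x y \<le> contraction w" if "x \<in> axis_point ` cylinder w" "y \<in> axis_point ` cylinder w" for x y
    using that by (auto simp: cylinder_def)
  then show "bounded (axis_point ` cylinder w)" "diameter (axis_point ` cylinder w) \<le> contraction w"
    using contraction_pos[of w] unfolding bounded_two_points
    by (auto intro!: diameter_le simp: dist_norm)
qed

lemma hausdorff_measure_limit_set_eq_0:
  assumes t: "ln 2 / ln 3 < t"
  shows "hausdorff_measure t (limit_set (axis_point ` {0..1}) binary_words prefix_rel branch) = 0"
proof -
  let ?J = "limit_set (axis_point ` {0..1}) binary_words prefix_rel branch"
  have "0 < t" using t ln_2_div_ln_3_nonneg by linarith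
  have "hausdorff_premeasure t \<delta> ?J = 0" if "0 < \<delta>" for \<delta>
  proof -
    have small: "hausdorff_premeasure t \<delta> ?J \<le> 0 + ennreal \<epsilon>" if "0 < \<epsilon>" for \<epsilon>
    proof -
      obtain M L where le: "1 \<le> M" "M \<le> L" "(1 / 2) ^ M < \<delta>"
          and sum: "(\<Sum>w\<in>spine_cut M L. contraction w powr t) < \<epsilon>"
        using exists_spine_cut_sum_less[OF t \<open>0 < \<epsilon>\<close> \<open>0 < \<delta>\<close>] by blast
      have "contraction w \<le> \<delta>" if "w \<in> spine_cut M L" for w
      proof -
        have "M \<le> length w" using that le by (auto simp: spine_cut_def)
        then have "(1 / 2 :: real) ^ length w \<le> (1 / 2) ^ M"
          by (intro power_decreasing) auto
        with contraction_le[of w] le show ?thesis by linarith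
      qed
      then have "hausdorff_premeasure t \<delta> ?J
          \<le> (\<Sum>w\<in>spine_cut M L. hausdorff_gauge t (axis_point ` cylinder w))"
        using \<open>0 < \<delta>\<close> diameter_cylinder_le(1) order_trans[OF diameter_cylinder_le(2)]
        by (intro hausdorff_premeasure_le_finite_cover finite_spine_cut limit_set_subset_spine_cut)
          simp_all
      also have "\<dots> \<le> (\<Sum>w\<in>spine_cut M L. ennreal (contraction w powr t))"
      proof (rule sum_mono)
        fix w
        show "hausdorff_gauge t (axis_point ` cylinder w) \<le> ennreal (contraction w powr t)"
          using \<open>0 < t\<close> diameter_cylinder_le[of w] diameter_ge_0[OF diameter_cylinder_le(1)[of w]]
          by (auto simp: hausdorff_gauge_def intro!: ennreal_leI powr_mono2)
      qed
      also have "\<dots> = ennreal (\<Sum>w\<in>spine_cut M L. contraction w powr t)"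
        by (rule sum_ennreal) simp
      also have "\<dots> \<le> ennreal \<epsilon>" using sum by (intro ennreal_leI) simp
      finally show ?thesis by simp
    qed
    have "hausdorff_premeasure t \<delta> ?J \<le> 0"
      by (rule ennreal_le_epsilon) (rule small)
    then show ?thesis by simp
  qed
  then have "hausdorff_measure t ?J \<le> 0"
    unfolding hausdorff_measure_def by (intro SUP_least) auto
  then show ?thesis by simp
qed

section \<open>Binary expansions as paths\<close>

definition digit :: "real \<Rightarrow> nat \<Rightarrow> nat"
  where "digit x i = nat (\<lfloor>2 ^ Suc i * x\<rfloor> mod 2)"

text \<open>
The first letter selects the subtree that is triadic from the start. The remaining letters are
the binary digits of \<open>x\<close>, and the value at \<open>n\<close> is the vertex of height \<open>n\<close> on the path.
\<close>

definition address :: "real \<Rightarrow> nat \<Rightarrow> nat list"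
  where "address x n = take n (1 # map (digit x) [0..<n])"

lemma digit_eq: "digit x i = 0 \<or> digit x i = 1"
  by (auto simp: digit_def)

lemma address_0 [simp]: "address x 0 = []"
  by (simp add: address_def)

lemma address_Suc: "address x (Suc n) = 1 # map (digit x) [0..<n]"
  by (simp add: address_def take_map)

lemma address_in_tree_boundary: "address x \<in> tree_boundary binary_words prefix_rel"
proof -
  have words: "1 # map (digit x) [0..<n] \<in> binary_words" for n
    using digit_eq by (simp add: binary_words_def image_subset_iff)
  have "address x (Suc n) \<in> tree_succs prefix_rel (address x n)" for n
  proof (cases n)
    case 0
    then show ?thesis by (simp add: tree_succs_prefix_rel address_Suc)
  next
    case (Suc m)
    then have "address x (Suc n) = address x n @ [digit x m]" "address x n \<in> binary_words"
      using words[of m] by (simp_all add: address_Suc)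
    then show ?thesis using digit_eq[of x m] by (auto simp: tree_succs_prefix_rel)
  qed
  then show ?thesis by (simp add: tree_boundary_def)
qed

lemma floor_double: "\<lfloor>2 * z\<rfloor> = 2 * \<lfloor>z\<rfloor> + \<lfloor>2 * z\<rfloor> mod 2" for z :: real
proof -
  have "2 * \<lfloor>z\<rfloor> \<le> \<lfloor>2 * z\<rfloor>" "\<lfloor>2 * z\<rfloor> \<le> 2 * \<lfloor>z\<rfloor> + 1" by linarith+
  then show ?thesis by presburger
qed

text \<open>
The first \<open>m\<close> digits of a number in \<open>[0, 1)\<close> determine the dyadic interval of length \<open>2\<^sup>-\<^sup>m\<close> that
contains it, because \<open>\<lfloor>2\<^sup>m x\<rfloor>\<close> is computed from them recursively.
\<close>

lemma same_digits_close:
  assumes xy: "x \<in> {0..<1}" "y \<in> {0..<1}" and same: "\<And>i. i < m \<Longrightarrow> digit x i = digit y i"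
  shows "\<bar>x - y\<bar> \<le> (1 / 2) ^ m"
proof -
  have "\<lfloor>2 ^ m * x\<rfloor> = \<lfloor>2 ^ m * y\<rfloor>"
    using same
  proof (induction m)
    case 0
    have "\<lfloor>x\<rfloor> = 0" "\<lfloor>y\<rfloor> = 0" using xy by (simp_all add: floor_eq_iff)
    then show ?case by simp
  next
    case (Suc m)
    then have "\<lfloor>2 ^ m * x\<rfloor> = \<lfloor>2 ^ m * y\<rfloor>" "digit x m = digit y m" by auto
    then show ?case
      using floor_double[of "2 ^ m * x"] floor_double[of "2 ^ m * y"]
      by (simp add: digit_def mult.assoc eq_nat_nat_iff)
  qed
  then have "\<bar>2 ^ m * x - 2 ^ m * y\<bar> < 1" by linarith
  then have "2 ^ m * \<bar>x - y\<bar> < 1"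
    by (simp add: abs_mult flip: right_diff_distrib)
  then show ?thesis by (simp add: field_simps power_divide)
qed

text \<open>
The two cylinders leave out the middle third of a cylinder of length \<open>3\<^sup>-\<^sup>|\<^sup>u\<^sup>| / 2\<close>.
\<close>

lemma dist_siblings_ge:
  assumes "p \<in> axis_point ` cylinder (1 # u @ [0])" "q \<in> axis_point ` cylinder (1 # u @ [1])"
  shows "(1 / 3) ^ length u / 6 \<le> dist p q"
proof -
  have r: "ratio ((1 # u) @ [i]) = 1 / 3" for i by (simp add: ratio_def)
  have "cylinder ((1 # u) @ [0]) = {left_end (1 # u) .. left_end (1 # u) + contraction (1 # u) / 3}"
    "cylinder ((1 # u) @ [1]) \<subseteq> {left_end (1 # u) + 2 * contraction (1 # u) / 3 ..}"
    unfolding cylinder_def left_end_snoc contraction_snoc r by auto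
  then have "contraction (1 # u) / 3 \<le> dist p q"
    using assms by (auto simp: subset_iff)
  then show ?thesis by (simp only: contraction_Cons_1)
qed

text \<open>
The first digit \<open>m\<close> at which the expansions differ controls both distances: \<open>x\<close> and \<open>y\<close> lie in a common dyadic
interval of length \<open>2\<^sup>-\<^sup>m\<close>, whereas their images are separated by the removed middle third of
a cylinder of length \<open>3\<^sup>-\<^sup>m / 2\<close>.
\<close>

lemma address_separation:
  assumes xy: "x \<in> {0..<1}" "y \<in> {0..<1}" "x \<noteq> y"
    and P: "\<And>x n. P x \<in> axis_point ` cylinder (address x n)"
  shows "\<exists>m. \<bar>x - y\<bar> \<le> (1 / 2) ^ m \<and> (1 / 3) ^ m / 6 \<le> dist (P x) (P y)"
proof -
  have "\<exists>m. digit x m \<noteq> digit y m"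
  proof (rule ccontr)
    assume "\<nexists>m. digit x m \<noteq> digit y m"
    then have "\<bar>x - y\<bar> \<le> (1 / 2) ^ m" for m
      using same_digits_close[OF xy(1,2)] by blast
    then have "\<bar>x - y\<bar> \<le> 0"
      by (intro LIMSEQ_le_const[OF LIMSEQ_power_zero[of "1 / 2 :: real"]]) auto
    with xy(3) show False by simp
  qed
  then obtain m where m: "digit x m \<noteq> digit y m" "\<And>i. i < m \<Longrightarrow> digit x i = digit y i"
    using exists_least_iff[of "\<lambda>m. digit x m \<noteq> digit y m"] by blast
  define u where "u = map (digit x) [0..<m]"
  have u: "length u = m" "map (digit y) [0..<m] = u"
    using m(2) by (auto simp: u_def)
  have addr: "address x (Suc (Suc m)) = 1 # u @ [digit x m]" "address y (Suc (Suc m)) = 1 # u @ [digit y m]"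
    using u by (simp_all add: address_Suc u_def)
  have "(1 / 3) ^ m / 6 \<le> dist (P x) (P y)"
  proof (cases "digit x m = 0")
    case True
    then have "digit y m = 1" using m(1) digit_eq[of y m] by auto
    then show ?thesis
      using dist_siblings_ge[of "P x" u "P y"] P[of x "Suc (Suc m)"] P[of y "Suc (Suc m)"] True u(1)
      by (simp only: addr)
  next
    case False
    then have "digit x m = 1" "digit y m = 0" using m(1) digit_eq[of x m] digit_eq[of y m] by auto
    then show ?thesis
      using dist_siblings_ge[of "P y" u "P x"] P[of x "Suc (Suc m)"] P[of y "Suc (Suc m)"] u(1)
      by (simp only: addr dist_commute[of "P x"])
  qed
  with same_digits_close[OF xy(1,2) m(2)] show ?thesis by blast
qed

text \<open>
The map that sends \<open>x\<close> to the point coded by its address inverts the Cantor function, up to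
scaling.
\<close>

lemma hausdorff_measure_limit_set_nonzero:
  assumes t: "0 \<le> t" "t \<le> ln 2 / ln 3"
  shows "hausdorff_measure t (limit_set (axis_point ` {0..1}) binary_words prefix_rel branch) \<noteq> 0"
proof (rule hausdorff_measure_nonzero)
  let ?P = "\<lambda>x. coding_map (axis_point ` {0..1}) prefix_rel branch (address x)"
  show "?P ` {0..<1} \<subseteq> limit_set (axis_point ` {0..1}) binary_words prefix_rel branch"
    using address_in_tree_boundary by (auto simp: limit_set_def)
  fix x y :: real assume xy: "x \<in> {0..<1}" "y \<in> {0..<1}" "x \<noteq> y"
  obtain m where m: "\<bar>x - y\<bar> \<le> (1 / 2) ^ m" "(1 / 3) ^ m / 6 \<le> dist (?P x) (?P y)"
    using address_separation[OF xy, of ?P] coding_map_in_cylinder[OF address_in_tree_boundary] by blast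
  note m(1)
  also have "(1 / 2 :: real) ^ m \<le> ((1 / 3) ^ m) powr t"
    using t by (intro half_power_le_third_power_powr)
  also have "\<dots> \<le> (6 * dist (?P x) (?P y)) powr t"
    using m(2) t by (intro powr_mono2) auto
  also have "\<dots> = 6 powr t * dist (?P x) (?P y) powr t"
    by (simp add: powr_mult)
  finally show "\<bar>x - y\<bar> \<le> 6 powr t * dist (?P x) (?P y) powr t" .
qed (use t in auto)

section \<open>Dimension and exponents of the system\<close>

lemma hausdorff_dim_limit_set_branch:
  "hausdorff_dim (limit_set (axis_point ` {0..1}) binary_words prefix_rel branch) = ereal (ln 2 / ln 3)"
  unfolding hausdorff_dim_def
proof (rule Inf_ereal_threshold)
  fix t :: real assume t: "ln 2 / ln 3 < t"
  then have "0 \<le> t" using ln_2_div_ln_3_nonneg by linarith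
  then show "t \<in> {t. 0 \<le> t \<and>
      hausdorff_measure t (limit_set (axis_point ` {0..1}) binary_words prefix_rel branch) = 0}"
    using hausdorff_measure_limit_set_eq_0[OF t] by simp
next
  fix t :: real
  assume "t \<in> {t. 0 \<le> t \<and>
      hausdorff_measure t (limit_set (axis_point ` {0..1}) binary_words prefix_rel branch) = 0}"
  then show "ln 2 / ln 3 \<le> t"
    using hausdorff_measure_limit_set_nonzero[of t] by force
qed

theorem theorem1p2:
  shows "\<exists>(d::nat) (X :: (nat \<Rightarrow>\<^sub>0 real) set) (T :: nat list set) (r :: (nat list \<times> nat list) set)
      (\<phi> :: nat list \<Rightarrow> (nat \<Rightarrow>\<^sub>0 real) \<Rightarrow> (nat \<Rightarrow>\<^sub>0 real)).
    conformal_TIFS d X T r \<phi> \<and>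
    hausdorff_dim (limit_set X T r \<phi>) = beta_star d X T r \<phi> \<and>
    beta_star d X T r \<phi> = ereal (ln 2 / ln 3) \<and>
    ereal (ln 2 / ln 3) < 1 \<and>
    1 = beta d X T r \<phi>"
proof (rule exI[of _ 1], rule exI[of _ "axis_point ` {0..1}"], rule exI[of _ binary_words],
    rule exI[of _ prefix_rel], rule exI[of _ branch], intro conjI)
  show "conformal_TIFS 1 (axis_point ` {0..1}) binary_words prefix_rel branch"
    by (rule conformal_TIFS_branch)
  show "hausdorff_dim (limit_set (axis_point ` {0..1}) binary_words prefix_rel branch)
      = beta_star 1 (axis_point ` {0..1}) binary_words prefix_rel branch"
    by (simp only: hausdorff_dim_limit_set_branch beta_star_branch)
  have "ln 2 < ln (3::real)" by simp
  then show "ereal (ln 2 / ln 3) < 1" by (simp add: one_ereal_def)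
qed (simp_all only: beta_star_branch beta_branch)

end
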